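(* Let $k\ge 1$. If $\langle L_{2k-1},L_{2k-2}\rangle_1\neq 0$, then the monic skew orthogonal polynomials $\pi_{2k,1}$ and $\pi_{2k+1,1}$ both exist, $\pi_{2k,1}$ is unique, and $\pi_{2k+1,1}$ is unique up to the addition of a multiple of $\pi_{2k,1}$. Moreover, $\langle L_{2k},L_{2k-1}\rangle_1=0$ and the skew orthogonal polynomials are given by $$\pi_{2k,1}=L_{2k}-\frac{\langle L_{2k},L_{2k-2}\rangle_1}{\langle L_{2k-1},L_{2k-2}\rangle_1}L_{2k-1},$$ $$\pi_{2k+1,1}=L_{2k+1}-\frac{\langle L_{2k+1},L_{2k-2}\rangle_1}{\langle L_{2k-1},L_{2k-2}\rangle_1}L_{2k-1}+\frac{\langle L_{2k+1},L_{2k-1}\rangle_1}{\langle L_{2k-1},L_{2k-2}\rangle_1}L_{2k-2}+c\,\pi_{2k,1},$$ where $c$ is an arbitrary constant.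
   Context: $M>N$ are positive integers with $N$ even, $\tau>-1$, $\tau\ne0$, $\tilde\tau=\frac{\tau}{2(1+\tau)}$, and $t\in\mathbb{C}$, $t\neq0$. $\mathbb{R}_+$ denotes the integration contour from $0$ to $\infty$: it is the half-line $[0,\infty)$ when $t/\tilde\tau\notin[0,\infty)$; when $t/\tilde\tau$ is on or too close to $(0,\infty)$, the half-line is deformed slightly into the upper or lower half plane so as to avoid $t/\tilde\tau$. All integrals $\int_0^\infty$ are along this contour. The weight is $$w(x)=e^{-\frac{Mx}{2}}x^{\frac{M-N-1}{2}}(t-\tilde\tau x)^{-\frac12},$$ with a branch of the square root that is continuous along the contour. Put $\epsilon(x)=\frac12\mathrm{sgn}(x)$ (on a deformed contour $\epsilon(x-y)=\pm\frac12$ according to whether $x$ comes after or before $y$ along the contour), and define the skew product $$\langle f,g\rangle_1=\int_0^\infty\int_0^\infty\epsilon(x-y)f(x)g(y)w(x)w(y)\,dx\,dy .$$ $L_j$ is the monic Laguerre polynomial of degree $j$ orthogonal with respect to $w_0(x)=x^{M-N}e^{-Mx}$: $\int_0^\infty L_j(x)L_k(x)w_0(x)\,dx=\delta_{jk}h_{j,0}$. The monic skew orthogonal polynomials $\pi_{2k,1}$ (degree $2k$) and $\pi_{2k+1,1}$ (degree $2k+1$) are monic polynomials satisfying $$\langle\pi_{2k+1,1},y^j\rangle_1=\langle\pi_{2k,1},y^j\rangle_1=0,\qquad j=0,\ldots,2k-1 .$$ *)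

theory Defs
  imports "HOL-Analysis.Analysis" "HOL-Computational_Algebra.Polynomial"
begin

text \<open>A contour from \<open>0\<close> to \<open>\<infinity>\<close> is a parametrised simple curve \<open>\<gamma>\<close> on \<open>{0..}\<close> avoiding the
  branch point \<open>a\<close>.  The half-line itself, \<open>\<gamma> = of_real\<close>, is the undeformed case; it is admissible
  exactly if \<open>a\<close> is not on it.  Otherwise \<open>\<gamma>\<close> is a deformation of a bounded part of the half-line
  into one of the two closed half planes, staying in the right half plane so that the principal
  powers of \<open>x\<close> are continuous along it.  The library's \<open>piecewise_C1_differentiable_on\<close> allows
  unbounded derivatives near the break points, so finite length is required in addition.\<close>

definition half_line_contour :: "complex \<Rightarrow> (real \<Rightarrow> complex) \<Rightarrow> bool" where
  "half_line_contour a \<gamma> \<longleftrightarrow>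
     \<gamma> 0 = 0 \<and> (\<exists>R. \<forall>s\<ge>R. \<gamma> s = of_real s) \<and>
     inj_on \<gamma> {0..} \<and>
     \<gamma> piecewise_C1_differentiable_on {0..} \<and>
     (\<forall>b. set_integrable lborel {0..b} (\<lambda>s. vector_derivative \<gamma> (at s))) \<and>
     (\<forall>s>0. Re (\<gamma> s) > 0) \<and>
     ((\<forall>s\<ge>0. Im (\<gamma> s) \<ge> 0) \<or> (\<forall>s\<ge>0. Im (\<gamma> s) \<le> 0)) \<and>
     a \<notin> \<gamma> ` {0..}"

lemma half_line_contour_of_real:
  "half_line_contour a of_real \<longleftrightarrow> a \<notin> of_real ` {0..}"
proof -
  have d: "(of_real has_vector_derivative (1::complex)) (at s)" for s
    by (auto intro!: derivative_eq_intros has_vector_derivative_of_real[of "\<lambda>x. x" 1, simplified])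
  then have v: "vector_derivative of_real (at s) = (1::complex)" for s
    by (rule vector_derivative_at)
  have "(of_real :: real \<Rightarrow> complex) C1_differentiable_on {0..}"
    unfolding C1_differentiable_on_def using d by (intro exI[of _ "\<lambda>_. 1"]) auto
  then have "(of_real :: real \<Rightarrow> complex) piecewise_C1_differentiable_on {0..}"
    by (rule C1_differentiable_imp_piecewise)
  moreover have "set_integrable lborel {0..b} (\<lambda>s. 1 :: complex)" for b :: real
    by (rule borel_integrable_atLeastAtMost') auto
  ultimately show ?thesis
    unfolding half_line_contour_def by (auto simp: v inj_on_def)
qed

definition integral_along :: "(real \<Rightarrow> complex) \<Rightarrow> (complex \<Rightarrow> complex) \<Rightarrow> complex" where
  "integral_along \<gamma> f = (LBINT s:{0..}. f (\<gamma> s) * vector_derivative \<gamma> (at s))"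

definition sqrt_branch_on :: "complex set \<Rightarrow> (complex \<Rightarrow> complex) \<Rightarrow> (complex \<Rightarrow> complex) \<Rightarrow> bool" where
  "sqrt_branch_on A f \<rho> \<longleftrightarrow> continuous_on A \<rho> \<and> (\<forall>x\<in>A. (\<rho> x)\<^sup>2 = f x)"

definition tau_tilde :: "real \<Rightarrow> real" where
  "tau_tilde \<tau> = \<tau> / (2 * (1 + \<tau>))"

text \<open>The function \<open>\<rho>\<close> is the chosen branch of the square root of \<open>t - tau_tilde \<tau> * x\<close>.\<close>

definition weight1 :: "nat \<Rightarrow> nat \<Rightarrow> (complex \<Rightarrow> complex) \<Rightarrow> complex \<Rightarrow> complex" where
  "weight1 M N \<rho> x =
     exp (- (of_nat M * x / 2)) * x powr ((of_nat M - of_nat N - 1) / 2) * inverse (\<rho> x)"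

definition weight0 :: "nat \<Rightarrow> nat \<Rightarrow> complex \<Rightarrow> complex" where
  "weight0 M N x = x ^ (M - N) * exp (- (of_nat M * x))"

text \<open>Since \<open>\<gamma>\<close> is injective, \<open>\<epsilon>(x - y)\<close> for \<open>x = \<gamma> s\<close> and \<open>y = \<gamma> u\<close> is \<open>sgn (s - u) / 2\<close>.\<close>

definition skew_product1 ::
    "(real \<Rightarrow> complex) \<Rightarrow> (complex \<Rightarrow> complex) \<Rightarrow> (complex \<Rightarrow> complex) \<Rightarrow> (complex \<Rightarrow> complex) \<Rightarrow> complex"
  where
  "skew_product1 \<gamma> w f g =
     (LBINT s:{0..}. LBINT u:{0..}.
        of_real (sgn (s - u) / 2) * f (\<gamma> s) * g (\<gamma> u) * w (\<gamma> s) * w (\<gamma> u)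
          * vector_derivative \<gamma> (at s) * vector_derivative \<gamma> (at u))"

definition monic_of_degree :: "nat \<Rightarrow> complex poly \<Rightarrow> bool" where
  "monic_of_degree n p \<longleftrightarrow> degree p = n \<and> lead_coeff p = 1"

definition monic_orthogonal_polys ::
    "(real \<Rightarrow> complex) \<Rightarrow> (complex \<Rightarrow> complex) \<Rightarrow> (nat \<Rightarrow> complex poly) \<Rightarrow> bool" where
  "monic_orthogonal_polys \<gamma> w L \<longleftrightarrow>
     (\<forall>j. monic_of_degree j (L j)) \<and>
     (\<forall>j k. j \<noteq> k \<longrightarrow> integral_along \<gamma> (\<lambda>x. poly (L j) x * poly (L k) x * w x) = 0)"

definition skew_orthogonal_even ::
    "(complex poly \<Rightarrow> complex poly \<Rightarrow> complex) \<Rightarrow> nat \<Rightarrow> complex poly \<Rightarrow> bool" where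
  "skew_orthogonal_even S k p \<longleftrightarrow>
     monic_of_degree (2 * k) p \<and> (\<forall>j<2 * k. S p (monom 1 j) = 0)"

definition skew_orthogonal_odd ::
    "(complex poly \<Rightarrow> complex poly \<Rightarrow> complex) \<Rightarrow> nat \<Rightarrow> complex poly \<Rightarrow> bool" where
  "skew_orthogonal_odd S k q \<longleftrightarrow>
     monic_of_degree (2 * k + 1) q \<and> (\<forall>j<2 * k. S q (monom 1 j) = 0)"

end

theory Submission
  imports "Jordan_Normal_Form.Determinant" "HOL-Real_Asymp.Real_Asymp" Defs
begin

text \<open>Put \<open>\<sigma>(x) = x (t - T x)\<close> with \<open>T = tau_tilde \<tau>\<close>, and write \<open>w\<close> and \<open>w\<^sub>0\<close> for the two weights.
  The logarithmic derivative of \<open>\<sigma> w\<close> is rational with denominator \<open>\<sigma>\<close>, so \<open>(q \<sigma> w)' = (D q) w\<close> for a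
  polynomial \<open>D q\<close>, whose degree is \<open>degree q + 2\<close> because \<open>M T \<noteq> 0\<close>.  Since \<open>q \<sigma> w\<close> vanishes at both
  ends of the contour, one integration against \<open>\<epsilon>(x - y)\<close> turns \<open>(D q) w\<close> back into \<open>q \<sigma> w\<close>, and
  \<open>\<sigma> w\<^sup>2 = w\<^sub>0\<close>.  Hence
  \<open>\<langle>p, D q\<rangle>\<^sub>1 = \<integral> p q w\<^sub>0\<close>
  (lemma \<open>sgn_form_D\<close>): tested against the image of \<open>D\<close>, the skew form is the ordinary Laguerre
  moment form, and \<open>L n\<close> annihilates \<open>D q\<close> for \<open>degree q < n\<close>.

  Everything else is linear algebra, carried out in the locale \<open>skew_moment_form\<close>.  The polynomials
  of degree below \<open>2 k\<close> are \<open>D\<close> of those of degree below \<open>2 k - 2\<close> together with \<open>L (2 k - 1)\<close> and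
  \<open>L (2 k - 2)\<close>; that the sum is everything is where \<open>\<langle>L (2 k - 1), L (2 k - 2)\<rangle>\<^sub>1 \<noteq> 0\<close> enters
  (\<open>functional_vanishes\<close>).  A polynomial skew orthogonal to \<open>D q\<close> for all such \<open>q\<close> has only
  its top few Laguerre coefficients (\<open>in_span_of_two\<close>), so existence and uniqueness become a
  \<open>2 \<times> 2\<close> problem.  The identity \<open>\<langle>L (2 k), L (2 k - 1)\<rangle>\<^sub>1 = 0\<close> is a parity phenomenon: the form on the
  polynomials of degree at most \<open>2 k\<close>, a space of odd dimension, is degenerate, and a
  vector of its radical is a nontrivial combination of \<open>L (2 k)\<close> and \<open>L (2 k - 1)\<close>
  (\<open>S_consecutive_even\<close>).

  The argument uses \<open>\<integral> (L j)\<^sup>2 w\<^sub>0 \<noteq> 0\<close>.  On a deformed contour this integral has no sign, but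
  polynomials times exponentials have elementary primitives, so it equals the integral over the real
  half-line, where the moment form is positive definite (\<open>orthogonal_polys_norm\<close>).\<close>

section \<open>Skew forms with a moment functional\<close>

text \<open>A skew-symmetric matrix of odd size \<open>n\<close> is singular, as
  \<open>det A = det A\<^sup>T = (-1)\<^sup>n det A\<close>.\<close>

lemma skew_matrix_odd_kernel:
  fixes a :: "nat \<Rightarrow> nat \<Rightarrow> complex"
  assumes skew: "\<And>i j. a i j = - a j i" and "odd n"
  obtains v where "\<exists>i<n. v i \<noteq> 0" "\<And>i. i < n \<Longrightarrow> (\<Sum>j<n. a i j * v j) = 0"
proof -
  define A where "A = Matrix.mat n n (\<lambda>(i, j). a i j)"
  have A: "A \<in> carrier_mat n n"
    by (simp add: A_def)
  have "transpose_mat A = (-1) \<cdot>\<^sub>m A"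
    by (rule eq_matI) (auto simp: A_def skew[symmetric])
  then have "Determinant.det A = (-1) ^ n * Determinant.det A"
    using Determinant.det_transpose[OF A] det_smult[of "-1" A] A by simp
  then have "Determinant.det A = 0"
    using \<open>odd n\<close> by simp
  then obtain w where w: "w \<in> carrier_vec n" "w \<noteq> 0\<^sub>v n" "A *\<^sub>v w = 0\<^sub>v n"
    using det_0_iff_vec_prod_zero_field[OF A] by auto
  have "\<exists>i<n. vec_index w i \<noteq> 0"
  proof (rule ccontr)
    assume "\<not> (\<exists>i<n. vec_index w i \<noteq> 0)"
    then have "w = 0\<^sub>v n"
      using w(1) by (intro eq_vecI) auto
    with w(2) show False by simp
  qed
  moreover have "(\<Sum>j<n. a i j * vec_index w j) = 0" if "i < n" for i
  proof -
    have "vec_index (A *\<^sub>v w) i = (\<Sum>j<n. a i j * vec_index w j)"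
      using that w(1) by (auto simp: A_def scalar_prod_def lessThan_atLeast0 intro!: sum.cong)
    then show ?thesis
      using w(3) that by simp
  qed
  ultimately show ?thesis
    using that by blast
qed

lemma monic_expansion:
  assumes L: "\<And>j. monic_of_degree j (L j)" and "degree p < n"
  obtains c where "p = (\<Sum>j<n. smult (c j) (L j))"
proof -
  have "\<exists>c. p = (\<Sum>j<n. smult (c j) (L j))"
    using assms(2)
  proof (induction n arbitrary: p)
    case (Suc n)
    define r where "r = p - smult (coeff p n) (L n)"
    have "degree r \<le> n" and "coeff r n = 0"
      using Suc.prems L[of n] unfolding r_def
      by (auto simp: monic_of_degree_def intro!: degree_diff_le order.trans[OF degree_smult_le])
    show ?case
    proof (cases "n = 0")
      case True
      with \<open>degree r \<le> n\<close> \<open>coeff r n = 0\<close> have "r = 0"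
        by (metis le_zero_eq leading_coeff_0_iff)
      with True show ?thesis
        by (intro exI[of _ "\<lambda>_. coeff p n"]) (simp add: r_def)
    next
      case False
      with \<open>degree r \<le> n\<close> \<open>coeff r n = 0\<close> have "degree r < n"
        by (metis degree_0 leading_coeff_0_iff nat_less_le neq0_conv)
      then obtain c where "r = (\<Sum>j<n. smult (c j) (L j))"
        using Suc.IH by blast
      then show ?thesis
        by (intro exI[of _ "c(n := coeff p n)"]) (simp add: r_def algebra_simps)
    qed
  qed simp
  then show ?thesis
    using that by blast
qed

text \<open>The properties of the skew product that the argument uses: pairing against the image of \<open>D\<close> is
  the moment functional \<open>I\<close> of a product, for which the \<open>L j\<close> are orthogonal with nonzero norms.\<close>

locale skew_moment_form =
  fixes S :: "complex poly \<Rightarrow> complex poly \<Rightarrow> complex"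
    and I :: "complex poly \<Rightarrow> complex"
    and D :: "complex poly \<Rightarrow> complex poly"
    and L :: "nat \<Rightarrow> complex poly"
  assumes S_add: "S (p + q) r = S p r + S q r"
    and S_smult: "S (smult c p) r = c * S p r"
    and S_skew: "S p q = - S q p"
    and D_add: "D (p + q) = D p + D q"
    and D_smult: "D (smult c p) = smult c (D p)"
    and degree_D: "q \<noteq> 0 \<Longrightarrow> degree (D q) = degree q + 2"
    and S_D: "S p (D q) = I (p * q)"
    and L_monic: "monic_of_degree j (L j)"
    and L_orth: "j \<noteq> k \<Longrightarrow> I (L j * L k) = 0"
    and L_norm: "I (L j * L j) \<noteq> 0"
begin

lemma degree_L [simp]: "degree (L j) = j" and coeff_L [simp]: "coeff (L j) j = 1"
  using L_monic[of j] by (auto simp: monic_of_degree_def)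

lemma S_add_right: "S r (p + q) = S r p + S r q"
  using S_skew[of r] S_add[of p q r] by simp

lemma S_smult_right: "S r (smult c p) = c * S r p"
  using S_skew[of r] S_smult[of c p r] by simp

lemma S_self [simp]: "S p p = 0"
  using S_skew[of p p] by simp

lemma S_0 [simp]: "S 0 p = 0" "S p 0 = 0"
  using S_smult[of 0 0 p] S_smult_right[of p 0 0] by auto

lemma S_diff: "S (p - q) r = S p r - S q r"
  using S_add[of "p - q" q r] by simp

lemma S_sum_right: "S r (sum f A) = (\<Sum>i\<in>A. S r (f i))"
  by (induction A rule: infinite_finite_induct) (auto simp: S_add_right)

lemma D_0 [simp]: "D 0 = 0"
  using D_smult[of 0 0] by simp

lemma I_add: "I (p + q) = I p + I q"
  using S_D[of "p + q" 1] S_D[of p 1] S_D[of q 1] by (simp add: S_add)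

lemma I_smult: "I (smult c p) = c * I p"
  using S_D[of "smult c p" 1] S_D[of p 1] by (simp add: S_smult)

lemma I_sum: "I (sum f A) = (\<Sum>i\<in>A. I (f i))"
  using I_smult[of 0 0] by (induction A rule: infinite_finite_induct) (auto simp: I_add)

text \<open>The pairing is \<open>I (L n * q)\<close>, so ordinary orthogonality gives skew orthogonality to \<open>D q\<close>.\<close>

lemma S_L_D:
  assumes "degree q < n"
  shows "S (L n) (D q) = 0"
proof -
  obtain c where c: "q = (\<Sum>j<n. smult (c j) (L j))"
    using monic_expansion[OF L_monic assms] .
  show ?thesis
    unfolding S_D by (subst c) (simp add: sum_distrib_left I_sum I_smult L_orth)
qed

text \<open>Pairing \<open>p\<close> with \<open>D (L i)\<close> reads off its \<open>i\<close>-th coefficient in the basis \<open>L\<close>, up to the nonzero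
  norm of \<open>L i\<close>.\<close>

lemma in_span_of_two:
  assumes "degree p < m + 2" and kill: "\<And>q. degree q < m \<Longrightarrow> S p (D q) = 0"
  obtains a b where "p = smult a (L (m + 1)) + smult b (L m)"
proof -
  obtain c where c: "p = (\<Sum>j<m + 2. smult (c j) (L j))"
    using monic_expansion[OF L_monic assms(1)] .
  have "c i = 0" if "i < m" for i
  proof -
    have "S p (D (L i)) = (\<Sum>j<m + 2. c j * I (L j * L i))"
      unfolding S_D by (subst c) (simp add: sum_distrib_right I_sum I_smult del: sum.lessThan_Suc)
    also have "\<dots> = (\<Sum>j<m + 2. if j = i then c i * I (L i * L i) else 0)"
      by (intro sum.cong) (auto simp: L_orth)
    also have "\<dots> = c i * I (L i * L i)"
      using that by simp
    finally show ?thesis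
      using kill[of "L i"] that L_norm[of i] by simp
  qed
  then have "p = smult (c (m + 1)) (L (m + 1)) + smult (c m) (L m)"
    by (subst c) (simp add: algebra_simps)
  then show ?thesis
    using that by blast
qed

text \<open>Division with remainder: as \<open>D\<close> raises the degree by exactly two, leading terms can be removed
  down to degree one.\<close>

lemma division_by_D:
  assumes "degree p < m + 2"
  obtains q a b where "p = D q + [:a, b:]" "q = 0 \<or> degree q < m"
proof -
  have "\<exists>q a b. p = D q + [:a, b:] \<and> (q = 0 \<or> degree q < m)"
    using assms
  proof (induction m arbitrary: p)
    case 0
    then have "p = D 0 + [:coeff p 0, coeff p 1:]"
      by (intro poly_eqI) (auto simp: coeff_pCons coeff_eq_0 split: nat.splits)
    then show ?case
      by blast
  next
    case (Suc m)
    define x where "x = (monom 1 m :: complex poly)"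
    have x: "x \<noteq> 0" "degree x = m"
      by (simp_all add: x_def degree_monom_eq)
    define c where "c = coeff p (m + 2) / coeff (D x) (m + 2)"
    have "degree (D x) = m + 2" and nz: "coeff (D x) (m + 2) \<noteq> 0"
      using degree_D[OF x(1)] x(2) by (auto, metis leading_coeff_0_iff degree_0 add_2_eq_Suc' nat.distinct(1))
    then have le: "degree (p - smult c (D x)) \<le> m + 2"
      using Suc.prems by (auto intro!: degree_diff_le order.trans[OF degree_smult_le])
    have "coeff (p - smult c (D x)) (m + 2) = 0"
      using nz by (simp add: c_def)
    with le have "degree (p - smult c (D x)) < m + 2"
      by (metis (no_types) add_2_eq_Suc' degree_0 leading_coeff_0_iff le_neq_implies_less zero_less_Suc)
    then obtain q a b where q: "p - smult c (D x) = D q + [:a, b:]" "q = 0 \<or> degree q < m"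
      using Suc.IH by blast
    have "p = D (q + smult c x) + [:a, b:]"
      using q(1) by (simp add: D_add D_smult algebra_simps)
    moreover have "degree (q + smult c x) < Suc m"
      using q(2) x(2) by (auto intro!: degree_add_less simp: degree_smult_eq)
    ultimately show ?case
      by blast
  qed
  then show ?thesis
    using that by blast
qed

text \<open>The images \<open>D q\<close> with \<open>degree q < m\<close>, together with \<open>L (m + 1)\<close> and \<open>L m\<close>, span the polynomials of
  degree at most \<open>m + 1\<close>; this is the dual form of that statement.  Modulo the \<open>D q\<close> the two
  polynomials become linear polynomials with coefficient vectors \<open>(a1, b1)\<close> and \<open>(a0, b0)\<close>.  If these were
  proportional, \<open>S (L (m + 1)) (L m)\<close> would vanish, since \<open>S (L (m + 1))\<close> and \<open>S (L m)\<close> see only the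
  remainders.\<close>

lemma functional_vanishes:
  fixes F :: "complex poly \<Rightarrow> complex"
  assumes F_add: "\<And>p q. F (p + q) = F p + F q" and F_smult: "\<And>c p. F (smult c p) = c * F p"
    and kill: "\<And>q. degree q < m \<Longrightarrow> F (D q) = 0" and "F (L (m + 1)) = 0" and "F (L m) = 0"
    and nz: "S (L (m + 1)) (L m) \<noteq> 0" and "degree p < m + 2"
  shows "F p = 0"
proof -
  have lin: "[:a, b:] = smult a 1 + smult b [:0, 1:]" for a b :: complex
    by simp
  have eval: "G (D q + [:a, b:]) = a * G 1 + b * G [:0, 1:]"
    if "\<And>p q. G (p + q) = G p + G q" "\<And>c p. G (smult c p) = c * G p"
      "\<And>q. degree q < m \<Longrightarrow> G (D q) = 0" "q = 0 \<or> degree q < m"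
    for G :: "complex poly \<Rightarrow> complex" and q a b
  proof -
    have "G (D q) = 0"
      using that(2)[of 0 0] that(3)[of q] that(4) by auto
    then show ?thesis
      by (subst lin) (simp only: that(1,2) add_0)
  qed
  obtain q1 a1 b1 where L1: "L (m + 1) = D q1 + [:a1, b1:]" "q1 = 0 \<or> degree q1 < m"
    by (rule division_by_D[of "L (m + 1)" m]) simp
  obtain q0 a0 b0 where L0: "L m = D q0 + [:a0, b0:]" "q0 = 0 \<or> degree q0 < m"
    by (rule division_by_D[of "L m" m]) simp
  have F1: "a1 * F 1 + b1 * F [:0, 1:] = 0" and F0: "a0 * F 1 + b0 * F [:0, 1:] = 0"
    using eval[of F, OF F_add F_smult kill] L1 L0 assms(4,5) by metis+
  have G1: "S (L (m + 1)) (L j) = a * S (L (m + 1)) 1 + b * S (L (m + 1)) [:0, 1:]"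
    and G0: "S (L m) (L j) = a * S (L m) 1 + b * S (L m) [:0, 1:]"
    if "L j = D q + [:a, b:]" "q = 0 \<or> degree q < m" for j q a b
    using eval[of "S (L (m + 1))"] eval[of "S (L m)"] that
    by (simp_all add: S_add_right S_smult_right S_L_D)
  have det: "a1 * b0 - a0 * b1 \<noteq> 0"
  proof
    assume det0: "a1 * b0 - a0 * b1 = 0"
    have e: "a1 * S (L (m + 1)) 1 + b1 * S (L (m + 1)) [:0, 1:] = 0"
        "a0 * S (L m) 1 + b0 * S (L m) [:0, 1:] = 0"
        "a0 * S (L (m + 1)) 1 + b0 * S (L (m + 1)) [:0, 1:] = S (L (m + 1)) (L m)"
        "a1 * S (L m) 1 + b1 * S (L m) [:0, 1:] = - S (L (m + 1)) (L m)"
      using G1[OF L1] G1[OF L0] G0[OF L0] G0[OF L1] S_skew[of "L m" "L (m + 1)"] by simp_all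
    have "a1 * (a0 * x + b0 * y) = a0 * (a1 * x + b1 * y) + (a1 * b0 - a0 * b1) * y"
      and "b1 * (a0 * x + b0 * y) = b0 * (a1 * x + b1 * y) - (a1 * b0 - a0 * b1) * x" for x y
      by (simp_all add: algebra_simps)
    then have "a1 * S (L (m + 1)) (L m) = 0" and "b1 * S (L (m + 1)) (L m) = 0"
      unfolding e(3)[symmetric] using e(1) det0 by simp_all
    then show False
      using nz e(4) by auto
  qed
  have "(a1 * b0 - a0 * b1) * x = b0 * (a1 * x + b1 * y) - b1 * (a0 * x + b0 * y)"
    and "(a1 * b0 - a0 * b1) * y = a1 * (a0 * x + b0 * y) - a0 * (a1 * x + b1 * y)" for x y
    by (simp_all add: algebra_simps)
  note this[where x = "F 1" and y = "F [:0, 1:]"]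
  then have "(a1 * b0 - a0 * b1) * F 1 = 0" and "(a1 * b0 - a0 * b1) * F [:0, 1:] = 0"
    unfolding F1 F0 by simp_all
  with det have "F 1 = 0" "F [:0, 1:] = 0"
    by auto
  moreover obtain q a b where "p = D q + [:a, b:]" "q = 0 \<or> degree q < m"
    using division_by_D[OF assms(7)] .
  ultimately show ?thesis
    using eval[of F, OF F_add F_smult kill] by simp
qed

text \<open>The form on the \<open>m + 2\<close> dimensional space of polynomials of degree at most \<open>m + 1\<close> has a radical
  vector \<open>p\<close>, as \<open>m\<close> is odd.  Being orthogonal to the image of \<open>D\<close>, it is \<open>a L (m + 1) + b L m\<close>, and
  pairing it with \<open>L m\<close> and with \<open>L (m + 1)\<close> shows that a nonzero value would force \<open>a = b = 0\<close>.\<close>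

lemma S_consecutive_even:
  assumes "odd m"
  shows "S (L (m + 1)) (L m) = 0"
proof -
  have "odd (m + 2)"
    using assms by simp
  then obtain v where v: "\<exists>i<m + 2. v i \<noteq> 0"
      "\<And>i. i < m + 2 \<Longrightarrow> (\<Sum>j<m + 2. S (L i) (L j) * v j) = 0"
    using skew_matrix_odd_kernel[of "\<lambda>i j. S (L i) (L j)" "m + 2"] S_skew by blast
  define p where "p = (\<Sum>j<m + 2. smult (v j) (L j))"
  have pL: "S p (L i) = 0" if "i < m + 2" for i
    using v(2)[OF that] S_skew[of p "L i"]
    by (simp add: p_def S_sum_right S_smult_right mult.commute del: sum.lessThan_Suc)
  \<comment> \<open>\<open>p\<close> annihilates the basis \<open>L 0, \<dots>, L (m + 1)\<close>, hence the whole space.\<close>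
  have p0: "S p r = 0" if r: "degree r < m + 2" for r
  proof -
    obtain c where c: "r = (\<Sum>j<m + 2. smult (c j) (L j))"
      using monic_expansion[OF L_monic r] .
    show ?thesis
      by (subst c) (simp add: S_sum_right S_smult_right pL del: sum.lessThan_Suc)
  qed
  have "degree p < m + 2"
    unfolding p_def by (rule degree_sum_less) (auto intro: le_less_trans[OF degree_smult_le])
  moreover have "S p (D q) = 0" if "degree q < m" for q
    using that p0[of "D q"] degree_D[of q] by (cases "q = 0") auto
  ultimately obtain a b where ab: "p = smult a (L (m + 1)) + smult b (L m)"
    by (rule in_span_of_two)
  have "p \<noteq> 0"
  proof
    assume "p = 0"
    have indep: "v i = 0" if "i < n" "(\<Sum>j<n. smult (v j) (L j)) = 0" for i n
      using that
    proof (induction n)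
      case (Suc n)
      have "coeff (\<Sum>j<Suc n. smult (v j) (L j)) n = v n"
        by (simp add: coeff_sum coeff_eq_0)
      with Suc have "v n = 0" by simp
      with Suc show ?case
        by (auto simp: less_Suc_eq)
    qed simp
    show False
      using v(1) indep \<open>p = 0\<close> unfolding p_def by blast
  qed
  have "a * S (L (m + 1)) (L m) = 0"
    using pL[of m] by (simp add: ab S_add S_smult)
  moreover have "b * S (L m) (L (m + 1)) = 0"
    using pL[of "m + 1"] by (simp add: ab S_add S_smult)
  moreover have "a \<noteq> 0 \<or> b \<noteq> 0"
    using \<open>p \<noteq> 0\<close> ab by auto
  ultimately show ?thesis
    using S_skew[of "L m" "L (m + 1)"] by auto
qed

lemma skew_orthogonal_iff:
  "(\<forall>j<n. S p (monom 1 j) = 0) \<longleftrightarrow> (\<forall>r. degree r < n \<longrightarrow> S p r = 0)"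
proof (intro iffI allI impI)
  fix r :: "complex poly"
  assume *: "\<forall>j<n. S p (monom 1 j) = 0" and "degree r < n"
  have "r = (\<Sum>j\<le>degree r. smult (coeff r j) (monom 1 j))"
    by (simp add: smult_monom poly_as_sum_of_monoms)
  then have "S p r = (\<Sum>j\<le>degree r. coeff r j * S p (monom 1 j))"
    by (metis (no_types, lifting) S_sum_right S_smult_right sum.cong)
  also have "\<dots> = 0"
    using * \<open>degree r < n\<close> by (intro sum.neutral) auto
  finally show "S p r = 0" .
qed (auto simp: degree_monom_eq)

text \<open>The coefficients of \<open>P\<close> and \<open>Q\<close> are those that make the pairings with \<open>L m\<close> and \<open>L (m + 1)\<close> vanish; for
  \<open>P\<close> the second one is automatic by \<open>S_consecutive_even\<close>.  Two solutions of the same degree differ, up to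
  a multiple of \<open>P\<close>, by a polynomial of degree at most \<open>m + 1\<close> in the radical of the form there, which is zero.\<close>

theorem skew_orthogonal_polys:
  assumes "even m" and nz: "S (L (m + 1)) (L m) \<noteq> 0"
  defines "c \<equiv> S (L (m + 1)) (L m)"
  defines "P \<equiv> L (m + 2) - smult (S (L (m + 2)) (L m) / c) (L (m + 1))"
    and "Q \<equiv> L (m + 3) - smult (S (L (m + 3)) (L m) / c) (L (m + 1))
                 + smult (S (L (m + 3)) (L (m + 1)) / c) (L m)"
  shows even_skew_orthogonal_iff: "monic_of_degree (m + 2) p \<and> (\<forall>j<m + 2. S p (monom 1 j) = 0) \<longleftrightarrow> p = P"
    and odd_skew_orthogonal_iff: "monic_of_degree (m + 3) q \<and> (\<forall>j<m + 2. S q (monom 1 j) = 0) \<longleftrightarrow>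
          (\<exists>a. q = Q + smult a P)"
proof -
  have c: "S (L (m + 1)) (L m) = c" "S (L m) (L (m + 1)) = - c" "c \<noteq> 0"
    using nz S_skew[of "L m"] by (simp_all add: c_def)
  have orthI: "\<forall>r. degree r < m + 2 \<longrightarrow> S p r = 0"
    if "\<And>q. degree q < m \<Longrightarrow> S p (D q) = 0" "S p (L (m + 1)) = 0" "S p (L m) = 0" for p
    using functional_vanishes[of "S p" m] that nz by (auto simp: S_add_right S_smult_right)
  have unique: "d = 0" if "degree d < m + 2" "\<forall>r. degree r < m + 2 \<longrightarrow> S d r = 0" for d
  proof -
    have "S d (D q) = 0" if "degree q < m" for q
      using that \<open>\<forall>r. degree r < m + 2 \<longrightarrow> S d r = 0\<close> degree_D[of q] by (cases "q = 0") auto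
    with that(1) obtain a b where ab: "d = smult a (L (m + 1)) + smult b (L m)"
      by (rule in_span_of_two)
    have "S d (L m) = 0" "S d (L (m + 1)) = 0"
      using that(2) by auto
    with ab c show ?thesis
      by (auto simp: S_add S_smult)
  qed
  have P_orth: "\<forall>r. degree r < m + 2 \<longrightarrow> S P r = 0"
    using S_consecutive_even[of "m + 1"] \<open>even m\<close> c
    by (intro orthI) (simp_all add: P_def S_diff S_smult S_L_D)
  have Q_orth: "\<forall>r. degree r < m + 2 \<longrightarrow> S Q r = 0"
    using c by (intro orthI) (simp_all add: Q_def S_diff S_add S_smult S_L_D)
  have P_coeff: "coeff P (m + 2) = 1" "degree P \<le> m + 2"
    using coeff_L[of "m + 2"] unfolding P_def
    by (auto simp: coeff_eq_0 simp del: coeff_L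
          intro!: degree_diff_le order.trans[OF degree_smult_le])
  have Q_coeff: "coeff Q (m + 3) = 1" "degree Q \<le> m + 3"
    using coeff_L[of "m + 3"] unfolding Q_def
    by (auto simp: coeff_eq_0 simp del: coeff_L
          intro!: degree_diff_le degree_add_le order.trans[OF degree_smult_le])
  have monicI: "monic_of_degree n p" if "coeff p n = 1" "degree p \<le> n" for n p
    using that le_degree[of p n] by (auto simp: monic_of_degree_def)
  have lower: "degree p < Suc n" if "degree p \<le> Suc n" "coeff p (Suc n) = 0" for p :: "complex poly" and n
    using that by (metis degree_0 leading_coeff_0_iff le_neq_implies_less zero_less_Suc)
  show "monic_of_degree (m + 2) p \<and> (\<forall>j<m + 2. S p (monom 1 j) = 0) \<longleftrightarrow> p = P"
  proof
    assume "p = P"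
    then show "monic_of_degree (m + 2) p \<and> (\<forall>j<m + 2. S p (monom 1 j) = 0)"
      using P_orth P_coeff by (simp add: skew_orthogonal_iff monicI)
  next
    assume p: "monic_of_degree (m + 2) p \<and> (\<forall>j<m + 2. S p (monom 1 j) = 0)"
    then have "degree (p - P) < Suc (m + 1)"
      using P_coeff by (intro lower) (auto simp: monic_of_degree_def intro!: degree_diff_le)
    moreover have "\<forall>r. degree r < m + 2 \<longrightarrow> S (p - P) r = 0"
      using p P_orth by (simp add: skew_orthogonal_iff S_diff)
    ultimately show "p = P"
      using unique[of "p - P"] by simp
  qed
  show "monic_of_degree (m + 3) q \<and> (\<forall>j<m + 2. S q (monom 1 j) = 0) \<longleftrightarrow>
          (\<exists>a. q = Q + smult a P)"
  proof
    assume "\<exists>a. q = Q + smult a P"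
    then obtain a where q: "q = Q + smult a P" ..
    have "monic_of_degree (m + 3) q"
      using P_coeff Q_coeff unfolding q
      by (intro monicI) (auto simp: coeff_eq_0 intro!: degree_add_le order.trans[OF degree_smult_le])
    then show "monic_of_degree (m + 3) q \<and> (\<forall>j<m + 2. S q (monom 1 j) = 0)"
      using P_orth Q_orth unfolding skew_orthogonal_iff by (simp add: q S_add S_smult)
  next
    assume q: "monic_of_degree (m + 3) q \<and> (\<forall>j<m + 2. S q (monom 1 j) = 0)"
    define a where "a = coeff (q - Q) (m + 2)"
    have "degree (q - Q) < Suc (m + 2)"
      using q Q_coeff by (intro lower) (auto simp: monic_of_degree_def numeral_3_eq_3 intro!: degree_diff_le)
    then have "degree (q - Q - smult a P) < Suc (m + 1)"
      using P_coeff
      by (intro lower degree_diff_le[of "q - Q"] order.trans[OF degree_smult_le]) (auto simp: a_def)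
    moreover have "\<forall>r. degree r < m + 2 \<longrightarrow> S (q - Q - smult a P) r = 0"
      using q P_orth Q_orth unfolding skew_orthogonal_iff by (simp add: S_diff S_smult)
    ultimately have "q - Q - smult a P = 0"
      using unique[of "q - Q - smult a P"] by simp
    then show "\<exists>a. q = Q + smult a P"
      by (intro exI[of _ a]) (simp add: algebra_simps)
  qed
qed

end

section \<open>Integration by parts on the half-line\<close>

text \<open>\<open>A\<close> is meant to contain the corners of a contour.  A contour is one-sided at \<open>0\<close>, so only continuity is
  available there.\<close>

lemma half_line_FTC:
  fixes F f :: "real \<Rightarrow> complex"
  assumes "finite A" and cont: "continuous_on {0..} F"
    and deriv: "\<And>s. 0 < s \<Longrightarrow> s \<notin> A \<Longrightarrow> (F has_vector_derivative f s) (at s)"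
    and int: "set_integrable lborel {0..} f" and lim: "(F \<longlongrightarrow> 0) at_top" and "0 \<le> s"
  shows "(LBINT u:{0..s}. f u) = F s - F 0" and "(LBINT u:{s..}. f u) = - F s"
proof -
  have seg: "(LBINT u:{a..b}. f u) = F b - F a" if "0 \<le> a" "a \<le> b" for a b
  proof -
    have "set_integrable lborel {a..b} f"
      by (rule set_integrable_subset[OF int]) (use that in auto)
    moreover have "(f has_integral (F b - F a)) {a..b}"
      by (rule fundamental_theorem_of_calculus_interior_strong[OF \<open>finite A\<close> \<open>a \<le> b\<close>])
         (use that in \<open>auto intro!: deriv continuous_on_subset[OF cont]\<close>)
    ultimately show ?thesis
      by (simp add: set_borel_integral_eq_integral(2) integral_unique)
  qed
  from seg[of 0 s] \<open>0 \<le> s\<close> show "(LBINT u:{0..s}. f u) = F s - F 0"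
    by simp
  have "set_integrable lborel {s..} f"
    by (rule set_integrable_subset[OF int]) (use \<open>0 \<le> s\<close> in auto)
  then have "((\<lambda>b. LBINT u:{s..b}. f u) \<longlongrightarrow> (LBINT u:{s..}. f u)) at_top"
    by (intro tendsto_set_lebesgue_integral_at_top) auto
  moreover have "((\<lambda>b. LBINT u:{s..b}. f u) \<longlongrightarrow> 0 - F s) at_top"
  proof (rule Lim_transform_eventually)
    show "((\<lambda>b. F b - F s) \<longlongrightarrow> 0 - F s) at_top"
      by (intro tendsto_intros lim)
    show "\<forall>\<^sub>F b in at_top. F b - F s = (LBINT u:{s..b}. f u)"
      using eventually_ge_at_top[of s] by eventually_elim (use seg \<open>0 \<le> s\<close> in auto)
  qed
  ultimately have "(LBINT u:{s..}. f u) = 0 - F s"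
    by (rule tendsto_unique[OF trivial_limit_at_top_linorder])
  then show "(LBINT u:{s..}. f u) = - F s"
    by simp
qed

text \<open>The kernel \<open>\<epsilon>(s - u)\<close> is the Green's function of \<open>d/ds\<close>: it recovers a primitive that vanishes at both
  ends.\<close>

lemma half_line_sgn_FTC:
  fixes F f :: "real \<Rightarrow> complex"
  assumes "finite A" and "continuous_on {0..} F"
    and "\<And>s. 0 < s \<Longrightarrow> s \<notin> A \<Longrightarrow> (F has_vector_derivative f s) (at s)"
    and int: "set_integrable lborel {0..} f" and "(F \<longlongrightarrow> 0) at_top" and "0 \<le> s" and "F 0 = 0"
  shows "(LBINT u:{0..}. of_real (sgn (s - u) / 2) * f u) = F s"
proof -
  have int': "set_integrable lborel {0..s} f" "set_integrable lborel {s..} f"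
    using \<open>0 \<le> s\<close> by (auto intro: set_integrable_subset[OF int])
  \<comment> \<open>At \<open>u = s\<close> both indicators are \<open>1\<close> and cancel, which matches \<open>sgn 0 = 0\<close>.\<close>
  have "(LBINT u:{0..}. of_real (sgn (s - u) / 2) * f u)
      = (LBINT u. (indicator {0..s} u *\<^sub>R f u - indicator {s..} u *\<^sub>R f u) / 2)"
    unfolding set_lebesgue_integral_def using \<open>0 \<le> s\<close>
    by (intro Bochner_Integration.integral_cong) (auto simp: indicator_def sgn_if)
  also have "\<dots> = ((LBINT u:{0..s}. f u) - (LBINT u:{s..}. f u)) / 2"
    using int' unfolding set_lebesgue_integral_def set_integrable_def by simp
  also have "\<dots> = F s"
    using half_line_FTC[OF assms(1-6)] \<open>F 0 = 0\<close> by simp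
  finally show ?thesis .
qed

text \<open>The difference quotient form of \<open>has_vector_derivative\<close>, in which derivatives can be
  computed by cancelling factors.\<close>

lemma has_vector_derivative_iff_quotient:
  fixes f :: "real \<Rightarrow> 'a::real_normed_vector"
  shows "(f has_vector_derivative f') (at x) \<longleftrightarrow>
    ((\<lambda>y. (f y - f x) /\<^sub>R (y - x)) \<longlongrightarrow> f') (at x)"
proof -
  have "norm (f y - f x - (y - x) *\<^sub>R f') / norm (y - x) = norm ((f y - f x) /\<^sub>R (y - x) - f')"
    if "y \<noteq> x" for y
  proof -
    have "f y - f x - (y - x) *\<^sub>R f' = (y - x) *\<^sub>R ((f y - f x) /\<^sub>R (y - x) - f')"
      using that by (simp add: scaleR_diff_right)
    then show ?thesis
      using that by simp
  qed
  then have "((\<lambda>y. norm (f y - f x - (y - x) *\<^sub>R f') / norm (y - x)) \<longlongrightarrow> 0) (at x) \<longleftrightarrow>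
      ((\<lambda>y. norm ((f y - f x) /\<^sub>R (y - x) - f')) \<longlongrightarrow> 0) (at x)"
    by (intro filterlim_cong refl) (auto simp: eventually_at_filter)
  then show ?thesis
    unfolding has_vector_derivative_def has_derivative_iff_norm
    by (simp add: bounded_linear_scaleR_left tendsto_norm_zero_iff LIM_zero_iff)
qed

text \<open>The factorisation \<open>(r y - r x) (r y + r x) = f y - f x\<close> expresses the difference quotient of a continuous
  square root by that of \<open>f\<close>.\<close>

lemma has_vector_derivative_sqrt_branch:
  fixes r f :: "real \<Rightarrow> complex"
  assumes f: "(f has_vector_derivative f') (at x)" and r: "isCont r x" "r x \<noteq> 0"
    and sq: "\<forall>\<^sub>F y in nhds x. (r y)\<^sup>2 = f y"
  shows "(r has_vector_derivative f' / (2 * r x)) (at x)"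
  unfolding has_vector_derivative_iff_quotient
proof (rule Lim_transform_eventually)
  have lim: "((\<lambda>y. r y + r x) \<longlongrightarrow> 2 * r x) (at x)"
    unfolding mult_2 using r(1) by (intro tendsto_intros) (simp add: isCont_def)
  show "((\<lambda>y. ((f y - f x) /\<^sub>R (y - x)) / (r y + r x)) \<longlongrightarrow> f' / (2 * r x)) (at x)"
    using f r(2) unfolding has_vector_derivative_iff_quotient by (intro tendsto_divide lim) auto
  have "\<forall>\<^sub>F y in at x. r y + r x \<noteq> 0"
    using r(2) by (intro tendsto_imp_eventually_ne[OF lim]) auto
  moreover have "\<forall>\<^sub>F y in at x. (r y)\<^sup>2 = f y"
    using sq by (auto simp: eventually_at_filter elim: eventually_mono)
  ultimately show "\<forall>\<^sub>F y in at x. ((f y - f x) /\<^sub>R (y - x)) / (r y + r x) = (r y - r x) /\<^sub>R (y - x)"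
  proof eventually_elim
    case (elim y)
    have "f y - f x = (r y - r x) * (r y + r x)"
      using elim eventually_nhds_x_imp_x[OF sq] by (simp add: algebra_simps power2_eq_square)
    with elim show ?case
      by (simp add: scaleR_conv_of_real)
  qed
qed

section \<open>Skew forms with the sign kernel\<close>

text \<open>The skew product after pulling it back to the parameter line; the weight and the velocity of the
  contour are absorbed into \<open>f\<close> and \<open>g\<close>.\<close>

definition sgn_form :: "(real \<Rightarrow> complex) \<Rightarrow> (real \<Rightarrow> complex) \<Rightarrow> complex" where
  "sgn_form f g = (LBINT s. LBINT u. of_real (sgn (s - u) / 2) * f s * g u)"

lemma integrable_sgn_kernel:
  fixes f g :: "real \<Rightarrow> complex"
  assumes f: "integrable lborel f" and g: "integrable lborel g"
  shows "integrable (lborel \<Otimes>\<^sub>M lborel) (\<lambda>(s, u). of_real (sgn (s - u) / 2) * f s * g u)"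
proof -
  have [measurable]: "f \<in> borel_measurable borel" "g \<in> borel_measurable borel"
    using f g by (auto dest: borel_measurable_integrable)
  have "integrable (lborel \<Otimes>\<^sub>M lborel) (\<lambda>(s, u). f s * g u)"
  proof (rule lborel_pair.Fubini_integrable)
    show "integrable lborel (\<lambda>s. LBINT u. norm (case (s, u) of (s, u) \<Rightarrow> f s * g u))"
      using f by (simp add: norm_mult)
  qed (use g in \<open>auto simp: split_beta\<close>)
  then show ?thesis
    by (rule Bochner_Integration.integrable_bound)
       (auto simp: split_beta norm_mult sgn_if intro!: AE_I2 mult_right_mono)
qed

lemma sgn_form_skew:
  assumes "integrable lborel f" and "integrable lborel g"
  shows "sgn_form f g = - sgn_form g f"
proof -
  have "sgn_form f g = (LBINT u. LBINT s. of_real (sgn (s - u) / 2) * f s * g u)"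
    unfolding sgn_form_def
    using lborel_pair.Fubini_integral[OF integrable_sgn_kernel[OF assms]] by simp
  also have "\<dots> = (LBINT u. LBINT s. - (of_real (sgn (u - s) / 2) * g u * f s))"
    by (intro Bochner_Integration.integral_cong refl) (auto simp: sgn_if)
  also have "\<dots> = - sgn_form g f"
    by (simp add: sgn_form_def)
  finally show ?thesis .
qed

lemma sgn_form_add:
  assumes "integrable lborel f" and "integrable lborel f'" and "integrable lborel g"
  shows "sgn_form (\<lambda>s. f s + f' s) g = sgn_form f g + sgn_form f' g"
proof -
  have int: "integrable lborel (\<lambda>s. LBINT u. of_real (sgn (s - u) / 2) * h s * g u)"
    and int': "AE s in lborel. integrable lborel (\<lambda>u. of_real (sgn (s - u) / 2) * h s * g u)"
    if "integrable lborel h" for h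
    using lborel_pair.integrable_fst[OF integrable_sgn_kernel[OF that \<open>integrable lborel g\<close>]]
      lborel_pair.AE_integrable_fst[OF integrable_sgn_kernel[OF that \<open>integrable lborel g\<close>]] .
  have "sgn_form (\<lambda>s. f s + f' s) g =
      (LBINT s. (LBINT u. of_real (sgn (s - u) / 2) * f s * g u)
              + (LBINT u. of_real (sgn (s - u) / 2) * f' s * g u))"
    unfolding sgn_form_def
  proof (rule integral_cong_AE)
    show "AE s in lborel. (LBINT u. of_real (sgn (s - u) / 2) * (f s + f' s) * g u) =
        (LBINT u. of_real (sgn (s - u) / 2) * f s * g u)
              + (LBINT u. of_real (sgn (s - u) / 2) * f' s * g u)"
      using int'[OF assms(1)] int'[OF assms(2)]
      by eventually_elim (simp only: distrib_left distrib_right Bochner_Integration.integral_add)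
  qed (use int[of "\<lambda>s. f s + f' s"] int assms in \<open>auto dest: borel_measurable_integrable\<close>)
  also have "\<dots> = sgn_form f g + sgn_form f' g"
    unfolding sgn_form_def using int assms by simp
  finally show ?thesis .
qed

lemma sgn_form_mult: "sgn_form (\<lambda>s. c * f s) g = c * sgn_form f g"
proof -
  have "sgn_form (\<lambda>s. c * f s) g =
      (LBINT s. c * (LBINT u. of_real (sgn (s - u) / 2) * f s * g u))"
    unfolding sgn_form_def integral_mult_right_zero[symmetric]
    by (intro Bochner_Integration.integral_cong refl) (simp add: mult_ac)
  then show ?thesis
    by (simp add: sgn_form_def)
qed

section \<open>Exponentially decaying integrands along a contour\<close>

lemma set_integrable_exp_minus:
  assumes "c > 0"
  shows "set_integrable lborel {0..} (\<lambda>s::real. C * exp (- (c * s)))"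
proof -
  have "(\<lambda>s. exp (- (c * s))) absolutely_integrable_on {0..}"
    using integrable_on_exp_minus_to_infinity[OF assms, of 0]
    by (intro nonnegative_absolutely_integrable_1) simp_all
  then have "set_integrable lborel {0..} (\<lambda>s. exp (- (c * s)))"
    unfolding set_integrable_def by (subst (asm) integrable_completion) auto
  then show ?thesis
    by (rule set_integrable_mult_right)
qed

lemma bounded_on_half_line:
  fixes f :: "real \<Rightarrow> complex"
  assumes "continuous_on {0..} f" and "(f \<longlongrightarrow> l) at_top"
  obtains C where "C \<ge> 0" "\<And>s. s \<ge> 0 \<Longrightarrow> norm (f s) \<le> C"
proof -
  have "\<forall>\<^sub>F s in at_top. dist (f s) l < 1"
    using assms(2) by (rule tendstoD) simp
  then obtain b where b: "\<And>s. s \<ge> b \<Longrightarrow> dist (f s) l < 1"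
    by (auto simp: eventually_at_top_linorder)
  have "compact (f ` {0..b})"
    by (intro compact_continuous_image continuous_on_subset[OF assms(1)]) auto
  then obtain B where B: "\<And>s. s \<in> {0..b} \<Longrightarrow> norm (f s) \<le> B"
    by (meson compact_imp_bounded bounded_iff imageI)
  show ?thesis
  proof (rule that[of "max B (norm l + 1)"])
    fix s :: real assume "s \<ge> 0"
    have "norm (f s) \<le> norm l + 1" if "s \<ge> b"
      using norm_triangle_ineq2[of "f s" l] b[OF that] by (simp add: dist_norm)
    then show "norm (f s) \<le> max B (norm l + 1)"
      using B[of s] \<open>s \<ge> 0\<close> by (cases "s \<ge> b") (auto simp: le_max_iff_disj)
  qed (use norm_ge_zero[of l] in linarith)
qed

lemma poly_exp_tendsto_0:
  assumes "m > 0"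
  shows "((\<lambda>s. poly p (of_real s) * exp (- of_real (m * s))) \<longlongrightarrow> (0::complex)) at_top"
  using assms
proof (induction p arbitrary: m)
  case (pCons c p)
  have 1: "((\<lambda>s::real. of_real (exp (- (m * s))) :: complex) \<longlongrightarrow> of_real 0) at_top"
    by (rule tendsto_of_real) (use \<open>m > 0\<close> in real_asymp)
  have 2: "((\<lambda>s::real. of_real (s * exp (- (m / 2 * s))) :: complex) \<longlongrightarrow> of_real 0) at_top"
    by (rule tendsto_of_real) (use \<open>m > 0\<close> in real_asymp)
  have 3: "((\<lambda>s. poly p (of_real s) * exp (- of_real (m / 2 * s))) \<longlongrightarrow> (0::complex)) at_top"
    using \<open>m > 0\<close> by (intro pCons.IH) simp
  have "((\<lambda>s. c * of_real (exp (- (m * s))) +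
         of_real (s * exp (- (m / 2 * s))) * (poly p (of_real s) * exp (- of_real (m / 2 * s))))
       \<longlongrightarrow> c * of_real 0 + of_real 0 * 0) at_top"
    by (intro tendsto_add tendsto_mult tendsto_const 1 2 3)
  moreover have "c * of_real (exp (- (m * s))) +
         of_real (s * exp (- (m / 2 * s))) * (poly p (of_real s) * exp (- of_real (m / 2 * s)))
      = poly (pCons c p) (of_real s) * exp (- of_real (m * s))" for s
  proof -
    have "c * X' + of_real (s * E) * (P * E') = (c + of_real s * P) * X"
      if "X' = X" "X = of_real E * E'" for X X' E' P :: complex and E
      by (simp add: that algebra_simps)
    moreover have "of_real (exp (- (m * s))) = (exp (- of_real (m * s)) :: complex)"
      by (simp flip: exp_of_real)
    moreover have "exp (- of_real (m * s)) =
        of_real (exp (- (m / 2 * s))) * (exp (- of_real (m / 2 * s)) :: complex)"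
      by (simp flip: exp_of_real exp_add)
    ultimately show ?thesis
      unfolding poly_pCons by blast
  qed
  ultimately show ?case
    by simp
qed simp

locale half_line =
  fixes a :: complex and \<gamma> :: "real \<Rightarrow> complex"
  assumes contour: "half_line_contour a \<gamma>"
begin

lemma path_0: "\<gamma> 0 = 0" and continuous_path: "continuous_on {0..} \<gamma>"
  and Re_path: "s > 0 \<Longrightarrow> Re (\<gamma> s) > 0" and path_avoids: "s \<ge> 0 \<Longrightarrow> \<gamma> s \<noteq> a"
  using contour by (auto simp: half_line_contour_def piecewise_C1_differentiable_on_def)

lemma path_eq_0_iff: "s \<ge> 0 \<Longrightarrow> \<gamma> s = 0 \<longleftrightarrow> s = 0"
  using path_0 Re_path[of s] by (cases "s = 0") auto

lemma real_tail: obtains R where "R > 0" "\<And>s. s \<ge> R \<Longrightarrow> \<gamma> s = of_real s"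
proof -
  obtain R where "\<And>s. s \<ge> R \<Longrightarrow> \<gamma> s = of_real s"
    using contour by (auto simp: half_line_contour_def)
  then show ?thesis
    by (intro that[of "max R 1"]) auto
qed

lemma eventually_real: "\<forall>\<^sub>F s in at_top. \<gamma> s = of_real s"
proof -
  obtain R where "\<And>s. s \<ge> R \<Longrightarrow> \<gamma> s = of_real s"
    using real_tail by blast
  then show ?thesis
    unfolding eventually_at_top_linorder by blast
qed

lemma smooth_path:
  obtains A where "finite A"
    "\<And>s. 0 < s \<Longrightarrow> s \<notin> A \<Longrightarrow> (\<gamma> has_vector_derivative vector_derivative \<gamma> (at s)) (at s)"
    "continuous_on ({0<..} - A) (\<lambda>s. vector_derivative \<gamma> (at s))"
proof -
  obtain A where A: "finite A" "\<gamma> C1_differentiable_on ({0..} - A)"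
    using contour by (auto simp: half_line_contour_def piecewise_C1_differentiable_on_def)
  then show ?thesis
    unfolding C1_differentiable_on_eq
    by (intro that[of A]) (auto simp: vector_derivative_works intro: continuous_on_subset)
qed

text \<open>Half of the exponential rate is given up to absorb the polynomial, so the bound needs no power of
  \<open>s\<close>.\<close>

lemma poly_exp_bound:
  assumes "m > 0"
  obtains C where "C \<ge> 0"
    "\<And>s. s \<ge> 0 \<Longrightarrow> norm (poly p (\<gamma> s) * exp (- (of_real m * \<gamma> s))) \<le> C * exp (- (m / 2 * s))"
proof -
  define f where "f s = poly p (\<gamma> s) * exp (of_real (m / 2 * s) - of_real m * \<gamma> s)" for s
  have "continuous_on {0..} f"
    unfolding f_def by (intro continuous_intros continuous_path)
  moreover have "(f \<longlongrightarrow> 0) at_top"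
  proof (rule Lim_transform_eventually)
    show "((\<lambda>s. poly p (of_real s) * exp (- of_real (m / 2 * s))) \<longlongrightarrow> (0::complex)) at_top"
      using poly_exp_tendsto_0[of "m / 2" p] assms by simp
    have "poly p (of_real s) * exp (- of_real (m / 2 * s)) = f s" if "\<gamma> s = of_real s" for s
    proof -
      have "of_real (m / 2 * s) - of_real m * of_real s = (- of_real (m / 2 * s) :: complex)"
        by simp
      then show ?thesis
        unfolding f_def that by (simp only:)
    qed
    then show "\<forall>\<^sub>F s in at_top. poly p (of_real s) * exp (- of_real (m / 2 * s)) = f s"
      using eventually_real by (rule eventually_mono[rotated])
  qed
  ultimately obtain C where C: "C \<ge> 0" "\<And>s. s \<ge> 0 \<Longrightarrow> norm (f s) \<le> C"
    using bounded_on_half_line by blast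
  have "norm (poly p (\<gamma> s) * exp (- (of_real m * \<gamma> s))) \<le> C * exp (- (m / 2 * s))" if "s \<ge> 0" for s
  proof -
    have "norm (poly p (\<gamma> s) * exp (- (of_real m * \<gamma> s))) = norm (f s) * exp (- (m / 2 * s))"
      by (simp add: f_def norm_mult mult.assoc mult_exp_exp)
    then show ?thesis
      using C(2)[OF that] by (simp add: mult_right_mono)
  qed
  with C(1) show ?thesis
    using that by blast
qed

text \<open>The velocity is integrable on the bounded, possibly deformed, part of the contour and equal to
  \<open>1\<close> on the rest, so the bound on \<open>g\<close> is enough.\<close>

lemma integrable_along_path:
  assumes cont: "continuous_on {0<..} g" and "c > 0"
    and bound: "\<And>s. s \<ge> 0 \<Longrightarrow> norm (g s) \<le> C * exp (- (c * s))"
  shows "set_integrable lborel {0..} (\<lambda>s. g s * vector_derivative \<gamma> (at s))"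
proof -
  define h where "h s = g s * vector_derivative \<gamma> (at s)" for s
  obtain A where A: "finite A" "continuous_on ({0<..} - A) (\<lambda>s. vector_derivative \<gamma> (at s))"
    using smooth_path by metis
  obtain R where R: "R > 0" "\<And>s. s \<ge> R \<Longrightarrow> \<gamma> s = of_real s"
    using real_tail by metis
  have "C \<ge> 0"
    using order.trans[OF norm_ge_zero bound[of 0]] by simp
  have "(\<lambda>s. indicator ({0<..} - A) s *\<^sub>R h s) \<in> borel_measurable borel"
    unfolding h_def using A
    by (intro borel_measurable_continuous_on_indicator continuous_intros continuous_on_subset[OF cont])
       (auto intro!: borel_open open_Diff finite_imp_closed)
  then have "(\<lambda>s. indicator {0..} s *\<^sub>R h s) \<in> borel_measurable borel"
    by (rule measurable_discrete_difference[where X = "insert 0 A"])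
       (use A in \<open>auto simp: indicator_def countable_finite\<close>)
  then have meas: "set_borel_measurable lborel {0..} h"
    by (simp add: set_borel_measurable_def)
  have "set_integrable lborel {0..R} (\<lambda>s. of_real C * vector_derivative \<gamma> (at s))"
    using contour by (intro set_integrable_mult_right) (simp add: half_line_contour_def)
  then have "set_integrable lborel {0..R} h"
  proof (rule set_integrable_bound)
    show "set_borel_measurable lborel {0..R} h"
      by (rule set_borel_measurable_subset[OF meas]) auto
    have "norm (g s) \<le> C" if "s \<ge> 0" for s
      using order.trans[OF bound[OF that] mult_left_le[of "exp (- (c * s))" C]] that \<open>C \<ge> 0\<close> \<open>c > 0\<close>
      by simp
    then show "AE s in lborel. s \<in> {0..R} \<longrightarrow>
        norm (h s) \<le> norm (of_real C * vector_derivative \<gamma> (at s))"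
      using \<open>C \<ge> 0\<close> by (auto simp: h_def norm_mult intro!: AE_I2 mult_right_mono)
  qed
  moreover have "set_integrable lborel {R<..} h"
  proof (rule set_integrable_bound)
    show "set_integrable lborel {R<..} (\<lambda>s. C * exp (- (c * s)))"
      by (rule set_integrable_subset[OF set_integrable_exp_minus[OF \<open>c > 0\<close>]]) (use R in auto)
    show "set_borel_measurable lborel {R<..} h"
      by (rule set_borel_measurable_subset[OF meas]) (use R in auto)
    have "vector_derivative \<gamma> (at s) = 1" if "s > R" for s
    proof (rule vector_derivative_at)
      show "(\<gamma> has_vector_derivative 1) (at s)"
        by (rule has_vector_derivative_transform_within_open[of of_real _ _ "{R<..}"])
           (use that R in \<open>auto intro!: derivative_eq_intros
              has_vector_derivative_of_real[of "\<lambda>x. x" 1, simplified]\<close>)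
    qed
    then show "AE s in lborel. s \<in> {R<..} \<longrightarrow> norm (h s) \<le> norm (C * exp (- (c * s)))"
      using bound R \<open>C \<ge> 0\<close> by (auto simp: h_def norm_mult intro!: AE_I2)
  qed
  ultimately have "set_integrable lborel ({0..R} \<union> {R<..}) h"
    by (rule set_integrable_Un) auto
  moreover have "{0..R} \<union> {R<..} = {0..}"
    using R by auto
  ultimately show ?thesis
    by (simp add: h_def[abs_def])
qed

end

section \<open>Moments of the Laguerre weight\<close>

text \<open>Such a \<open>P\<close> makes \<open>P(x) exp (- m x)\<close> a primitive of \<open>r(x) exp (- m x)\<close>.  It is built by repeated
  integration by parts, which lowers the degree of \<open>r\<close>.\<close>

lemma exp_primitive:
  fixes r :: "complex poly"
  assumes "m \<noteq> 0"
  obtains P where "pderiv P - smult m P = r"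
proof -
  have "\<exists>P. pderiv P - smult m P = r"
  proof (induction "degree r" arbitrary: r rule: less_induct)
    case less
    show ?case
    proof (cases "degree r = 0")
      case True
      then have "pderiv r = 0"
        by (simp add: pderiv_eq_0_iff)
      then show ?thesis
        using assms by (intro exI[of _ "smult (- 1 / m) r"]) (simp add: pderiv_smult pderiv_minus)
    next
      case False
      then have "degree (smult (1 / m) (pderiv r)) < degree r"
        by (intro le_less_trans[OF degree_smult_le]) (simp add: degree_pderiv)
      then obtain P where "pderiv P - smult m P = smult (1 / m) (pderiv r)"
        using less by blast
      then show ?thesis
        using assms
        by (intro exI[of _ "P + smult (- 1 / m) r"])
           (simp add: pderiv_smult pderiv_minus pderiv_add pderiv_diff smult_diff_right algebra_simps)
    qed
  qed
  then show ?thesis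
    using that by blast
qed

context half_line
begin

lemma integrable_poly_exp:
  assumes "m > 0"
  shows "set_integrable lborel {0..}
    (\<lambda>s. poly r (\<gamma> s) * exp (- (of_real m * \<gamma> s)) * vector_derivative \<gamma> (at s))"
proof -
  obtain C where C:
    "\<And>s. s \<ge> 0 \<Longrightarrow> norm (poly r (\<gamma> s) * exp (- (of_real m * \<gamma> s))) \<le> C * exp (- (m / 2 * s))"
    using poly_exp_bound[OF assms, of r] by blast
  show ?thesis
    by (rule integrable_along_path[OF _ _ C])
       (use assms in \<open>auto intro!: continuous_intros continuous_on_subset[OF continuous_path]\<close>)
qed

lemma integral_poly_exp:
  assumes "m > 0" and P: "pderiv P - smult (of_real m) P = r"
  shows "integral_along \<gamma> (\<lambda>x. poly r x * exp (- (of_real m * x))) = - poly P 0"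
proof -
  obtain A where A: "finite A"
    "\<And>s. 0 < s \<Longrightarrow> s \<notin> A \<Longrightarrow> (\<gamma> has_vector_derivative vector_derivative \<gamma> (at s)) (at s)"
    using smooth_path by metis
  define G where "G x = poly P x * exp (- (of_real m * x))" for x :: complex
  have deriv: "(G has_field_derivative poly r x * exp (- (of_real m * x))) (at x)" for x
    unfolding G_def P[symmetric]
    by (auto intro!: derivative_eq_intros poly_DERIV simp: algebra_simps)
  have "(LBINT s:{0..}. poly r (\<gamma> s) * exp (- (of_real m * \<gamma> s)) * vector_derivative \<gamma> (at s))
      = - G (\<gamma> 0)"
  proof (rule half_line_FTC(2)[OF A(1)])
    show "continuous_on {0..} (\<lambda>s. G (\<gamma> s))"
      unfolding G_def by (intro continuous_intros continuous_path)
    show "((\<lambda>s. G (\<gamma> s)) has_vector_derivative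
        poly r (\<gamma> s) * exp (- (of_real m * \<gamma> s)) * vector_derivative \<gamma> (at s)) (at s)"
      if "0 < s" "s \<notin> A" for s
      using field_vector_diff_chain_at[OF A(2)[OF that] deriv] by (simp add: o_def mult_ac)
    show "((\<lambda>s. G (\<gamma> s)) \<longlongrightarrow> 0) at_top"
    proof (rule Lim_transform_eventually)
      show "((\<lambda>s. poly P (of_real s) * exp (- of_real (m * s))) \<longlongrightarrow> (0::complex)) at_top"
        using assms(1) by (rule poly_exp_tendsto_0)
      show "\<forall>\<^sub>F s in at_top. poly P (of_real s) * exp (- of_real (m * s)) = G (\<gamma> s)"
        using eventually_real by eventually_elim (simp add: G_def)
    qed
  qed (use integrable_poly_exp[OF assms(1)] in auto)
  then show ?thesis
    by (simp add: integral_along_def G_def path_0)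
qed

end

text \<open>The undeformed half-line, on which the moments of squared moduli are positive; \<open>-1\<close> is an arbitrary point off it.\<close>

lemma half_line_of_real: "half_line (-1) of_real"
proof
  have "- 1 \<noteq> complex_of_real x" if "x \<ge> 0" for x
    using that by (auto simp: complex_eq_iff)
  then show "half_line_contour (-1) of_real"
    unfolding half_line_contour_of_real by auto
qed

text \<open>Both integrals are the value at the common starting point \<open>0\<close> of one primitive, up to sign; this
  replaces a contour deformation.\<close>

lemma (in half_line) integral_poly_exp_eq_real:
  assumes "m > 0"
  shows "integral_along \<gamma> (\<lambda>x. poly r x * exp (- (of_real m * x)))
       = integral_along of_real (\<lambda>x. poly r x * exp (- (of_real m * x)))"
proof -
  obtain P where "pderiv P - smult (of_real m) P = r"
    using exp_primitive[of "of_real m"] assms by auto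
  then show ?thesis
    using integral_poly_exp half_line.integral_poly_exp[OF half_line_of_real] assms by simp
qed

lemma vector_derivative_of_real [simp]: "vector_derivative complex_of_real (at s) = 1"
  by (rule vector_derivative_at) (auto intro!: derivative_eq_intros has_vector_derivative_of_real[of "\<lambda>x. x" 1, simplified])

text \<open>On the real line \<open>p * map_poly cnj p\<close> takes the values \<open>\<bar>p(s)\<bar>\<^sup>2\<close>, so the integrand is positive off a finite
  set.\<close>

lemma real_square_moment_nonzero:
  assumes "m > 0" and "p \<noteq> 0"
  shows "integral_along of_real
      (\<lambda>x. poly (p * map_poly cnj p * monom 1 n) x * exp (- (of_real m * x))) \<noteq> 0"
proof
  interpret R: half_line "-1" of_real
    by (rule half_line_of_real)
  define f where "f s = (norm (poly p (of_real s)))\<^sup>2 * s ^ n * exp (- (m * s))" for s :: real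
  have f: "poly (p * map_poly cnj p * monom 1 n) (of_real s) * exp (- (of_real m * of_real s))
      = of_real (f s)" for s
    unfolding f_def of_real_mult complex_norm_square
    by (simp add: poly_monom flip: exp_of_real)
  have int: "set_integrable lborel {0..} (\<lambda>s. complex_of_real (f s))"
    using R.integrable_poly_exp[OF assms(1), of "p * map_poly cnj p * monom 1 n"]
    by (simp only: f vector_derivative_of_real mult_1_right)
  then have "integrable lborel (\<lambda>s. complex_of_real (indicator {0..} s * f s))"
    unfolding set_integrable_def
    by (simp add: scaleR_conv_of_real flip: of_real_mult)
  then have int': "integrable lborel (\<lambda>s. indicator {0..} s * f s)"
    by (drule_tac integrable_Re) simp
  assume "integral_along of_real
      (\<lambda>x. poly (p * map_poly cnj p * monom 1 n) x * exp (- (of_real m * x))) = 0"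
  then have "(LBINT s:{0..}. complex_of_real (f s)) = 0"
    unfolding integral_along_def by (simp only: f vector_derivative_of_real mult_1_right)
  then have "complex_of_real (LBINT s. indicator {0..} s * f s) = 0"
    unfolding set_lebesgue_integral_def
    by (simp add: scaleR_conv_of_real flip: of_real_mult integral_complex_of_real)
  then have "(LBINT s. indicator {0..} s * f s) = 0"
    by simp
  then have "AE s in lborel. indicator {0..} s * f s = 0"
    by (subst (asm) integral_nonneg_eq_0_iff_AE[OF int'])
       (auto simp: f_def indicator_def)
  moreover have "finite {s. poly p (of_real s) = 0}"
  proof -
    have "of_real ` {s. poly p (of_real s) = 0} \<subseteq> {z. poly p z = 0}"
      by auto
    then have "finite (complex_of_real ` {s. poly p (of_real s) = 0})"
      using poly_roots_finite[OF \<open>p \<noteq> 0\<close>] finite_subset by blast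
    then show ?thesis
      by (rule finite_imageD) (auto simp: inj_on_def)
  qed
  then have "AE s in lborel. s \<notin> insert 0 {s. poly p (of_real s) = 0}"
    by (intro AE_not_in finite_imp_null_set_lborel) simp
  ultimately have "AE s in lborel. s \<notin> {0..1::real}"
    by eventually_elim (auto simp: f_def)
  then have "{0..1::real} \<in> null_sets lborel"
    by (subst (asm) AE_iff_null) (auto simp: atLeastAtMost_def atLeast_def atMost_def Int_def)
  then show False
    by (simp add: null_sets_def)
qed

text \<open>If the norm of \<open>L j\<close> were zero, \<open>L j\<close> would be orthogonal to every polynomial of degree at most \<open>j\<close>,
  in particular to its own complex conjugate, against positivity on the real half-line.\<close>

lemma (in half_line) orthogonal_polys_norm:
  assumes L: "monic_orthogonal_polys \<gamma> (weight0 M N) L" and "M > 0"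
  shows "integral_along \<gamma> (\<lambda>x. poly (L j * L j) x * weight0 M N x) \<noteq> 0"
proof
  define I where "I p = integral_along \<gamma> (\<lambda>x. poly p x * weight0 M N x)" for p
  have I_eq: "I p = integral_along \<gamma>
      (\<lambda>x. poly (p * monom 1 (M - N)) x * exp (- (of_real (real M) * x)))" for p
    by (simp add: I_def weight0_def poly_monom mult_ac)
  have int: "set_integrable lborel {0..}
      (\<lambda>s. poly p (\<gamma> s) * weight0 M N (\<gamma> s) * vector_derivative \<gamma> (at s))" for p
    using integrable_poly_exp[of "real M" "p * monom 1 (M - N)"] \<open>M > 0\<close>
    by (simp add: weight0_def poly_monom mult_ac)
  have I_add: "I (p + q) = I p + I q" for p q
    unfolding I_def integral_along_def
    by (subst set_integral_add(2)[OF int int, symmetric]) (simp add: algebra_simps)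
  have I_smult: "I (smult c p) = c * I p" for c p
    unfolding I_def integral_along_def
    by (subst set_integral_mult_right[symmetric]) (simp add: algebra_simps)
  have I_sum: "I (sum f A) = (\<Sum>i\<in>A. I (f i))" for f and A :: "nat set"
    using I_smult[of 0 0] by (induction A rule: infinite_finite_induct) (auto simp: I_add)
  have monic: "monic_of_degree i (L i)" for i
    using L by (simp add: monic_orthogonal_polys_def)
  assume "integral_along \<gamma> (\<lambda>x. poly (L j * L j) x * weight0 M N x) = 0"
  then have "I (L j * L j) = 0"
    by (simp add: I_def)
  moreover have "I (L j * L i) = 0" if "i \<noteq> j" for i
    using L that by (simp add: I_def monic_orthogonal_polys_def)
  ultimately have orth: "I (L j * L i) = 0" for i
    by (cases "i = j") simp_all
  have "degree (map_poly cnj (L j)) < Suc j"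
    using monic[of j] by (auto simp: monic_of_degree_def less_Suc_eq_le degree_map_poly)
  with monic obtain c where c: "map_poly cnj (L j) = (\<Sum>i<Suc j. smult (c i) (L i))"
    by (rule monic_expansion)
  have "I (L j * map_poly cnj (L j)) = 0"
    unfolding c by (simp add: sum_distrib_left I_sum I_smult orth del: sum.lessThan_Suc)
  moreover have "real M > 0" and "L j \<noteq> 0"
    using \<open>M > 0\<close> monic[of j] by (auto simp: monic_of_degree_def)
  ultimately show False
    using real_square_moment_nonzero[of "real M" "L j" "M - N"]
    unfolding I_eq integral_poly_exp_eq_real[OF \<open>real M > 0\<close>] by blast
qed

section \<open>The weight on the contour\<close>

text \<open>The parameter \<open>T\<close> stands for \<open>tau_tilde \<tau>\<close>.\<close>

locale laguerre_contour =
  fixes \<gamma> :: "real \<Rightarrow> complex" and \<rho> :: "complex \<Rightarrow> complex"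
    and t :: complex and T :: real and M N :: nat
  assumes contour: "half_line_contour (t / of_real T) \<gamma>"
    and branch: "sqrt_branch_on (\<gamma> ` {0..}) (\<lambda>x. t - of_real T * x) \<rho>"
    and T_nonzero: "T \<noteq> 0" and N_less_M: "N < M"
begin

sublocale half_line "t / of_real T" \<gamma>
  by unfold_locales (rule contour)

definition \<alpha> :: complex where
  "\<alpha> = (of_nat M - of_nat N - 1) / 2"

text \<open>The factor with \<open>\<sigma> w\<^sup>2 = w\<^sub>0\<close>.\<close>

definition \<sigma> :: "complex poly" where
  "\<sigma> = [:0, t, - of_real T:]"

text \<open>The polynomial with \<open>\<sigma> w' = \<nu> w\<close>.\<close>

definition \<nu> :: "complex poly" where
  "\<nu> = smult \<alpha> [:t, - of_real T:] + [:0, of_real T / 2:] - smult (of_nat M / 2) \<sigma>"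

text \<open>Chosen so that \<open>(q \<sigma> w)' = (D q) w\<close>.\<close>

definition D :: "complex poly \<Rightarrow> complex poly" where
  "D q = pderiv (q * \<sigma>) + q * \<nu>"

definition W :: "complex poly \<Rightarrow> real \<Rightarrow> complex" where
  "W p s = poly p (\<gamma> s) * weight1 M N \<rho> (\<gamma> s)"

text \<open>The integrand of the skew product, extended by zero to the whole line.\<close>

definition \<Phi> :: "complex poly \<Rightarrow> real \<Rightarrow> complex" where
  "\<Phi> p s = indicator {0..} s *\<^sub>R (W p s * vector_derivative \<gamma> (at s))"

lemma weight_eq: "weight1 M N \<rho> x = exp (- (of_nat M / 2 * x)) * x powr \<alpha> * inverse (\<rho> x)"
  by (simp add: weight1_def \<alpha>_def)

lemma \<alpha>_real: "\<alpha> = of_real (real (M - N - 1) / 2)"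
  using N_less_M by (simp add: \<alpha>_def of_nat_diff)

text \<open>Only \<open>q \<nu>\<close> reaches degree \<open>degree q + 2\<close>; the leading coefficient of \<open>\<nu>\<close> is \<open>M T / 2\<close>.\<close>

lemma degree_D:
  assumes "q \<noteq> 0"
  shows "degree (D q) = degree q + 2"
proof -
  have "\<sigma> \<noteq> 0" "degree \<sigma> = 2"
    using T_nonzero by (simp_all add: \<sigma>_def)
  have "coeff \<nu> 2 = of_nat M * of_real T / 2"
    by (simp add: \<nu>_def \<sigma>_def numeral_2_eq_2)
  moreover have "of_nat M * of_real T / 2 \<noteq> (0 :: complex)"
    using T_nonzero N_less_M by simp
  ultimately have "coeff \<nu> 2 \<noteq> 0"
    by metis
  moreover have "degree \<nu> \<le> 2"
    unfolding \<nu>_def \<sigma>_def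
    by (intro degree_diff_le degree_add_le order.trans[OF degree_smult_le]) auto
  ultimately have \<nu>: "degree \<nu> = 2" "\<nu> \<noteq> 0"
    using le_degree[of \<nu> 2] by auto
  have "degree (pderiv (q * \<sigma>)) < degree (q * \<nu>)"
    using assms \<nu> \<open>\<sigma> \<noteq> 0\<close> \<open>degree \<sigma> = 2\<close> by (simp add: degree_pderiv degree_mult_eq)
  then show ?thesis
    using assms \<nu> by (simp add: D_def degree_add_eq_right degree_mult_eq)
qed

lemma D_add: "D (p + q) = D p + D q"
  by (simp add: D_def distrib_right pderiv_add)

lemma D_smult: "D (smult c p) = smult c (D p)"
  by (simp add: D_def pderiv_smult smult_add_right)

lemma rho_square: "s \<ge> 0 \<Longrightarrow> (\<rho> (\<gamma> s))\<^sup>2 = t - of_real T * \<gamma> s"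
  using branch by (auto simp: sqrt_branch_on_def)

lemma rho_nonzero: "s \<ge> 0 \<Longrightarrow> \<rho> (\<gamma> s) \<noteq> 0"
  using rho_square[of s] path_avoids[of s] T_nonzero by (auto simp: field_simps)

lemma continuous_rho: "continuous_on {0..} (\<lambda>s. \<rho> (\<gamma> s))"
  using branch continuous_path
  by (auto simp: sqrt_branch_on_def intro: continuous_on_compose2)

text \<open>The contour stays away from the branch point and \<open>\<bar>\<rho>\<bar>\<^sup>2\<close> grows linearly along it.\<close>

lemma inverse_rho_bound:
  obtains C where "C \<ge> 0" "\<And>s. s \<ge> 0 \<Longrightarrow> norm (inverse (\<rho> (\<gamma> s))) \<le> C"
proof (rule bounded_on_half_line)
  show "continuous_on {0..} (\<lambda>s. inverse (\<rho> (\<gamma> s)))"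
    using rho_nonzero by (intro continuous_on_inverse continuous_rho) auto
  have "filterlim (\<lambda>s. \<bar>T\<bar> * s - norm t) at_top at_top"
    using T_nonzero by real_asymp
  then have "filterlim (\<lambda>s. (norm (\<rho> (\<gamma> s)))\<^sup>2) at_top at_top"
  proof (rule filterlim_at_top_mono)
    show "\<forall>\<^sub>F s in at_top. \<bar>T\<bar> * s - norm t \<le> (norm (\<rho> (\<gamma> s)))\<^sup>2"
      using eventually_real eventually_ge_at_top[of 0]
    proof eventually_elim
      case (elim s)
      have "\<bar>T\<bar> * s = norm (of_real T * complex_of_real s)"
        using elim by (simp add: norm_mult)
      also have "\<dots> \<le> norm t + norm (t - of_real T * complex_of_real s)"
        using norm_triangle_ineq4[of t "t - of_real T * complex_of_real s"] by simp
      also have "norm (t - of_real T * complex_of_real s) = (norm (\<rho> (\<gamma> s)))\<^sup>2"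
        using rho_square[of s] elim by (simp flip: norm_power)
      finally show ?case
        by simp
    qed
  qed
  then have "filterlim (\<lambda>s. sqrt ((norm (\<rho> (\<gamma> s)))\<^sup>2)) at_top at_top"
    by (rule filterlim_compose[OF sqrt_at_top])
  then have "((\<lambda>s. inverse (norm (\<rho> (\<gamma> s)))) \<longlongrightarrow> 0) at_top"
    by (intro tendsto_inverse_0_at_top) simp
  then show "((\<lambda>s. inverse (\<rho> (\<gamma> s))) \<longlongrightarrow> 0) at_top"
    by (intro tendsto_norm_zero_cancel[of "\<lambda>s. inverse (\<rho> (\<gamma> s))"]) (simp add: norm_inverse)
qed (use that in blast)

lemma norm_powr_alpha_le: "norm (x powr \<alpha>) \<le> 1 + norm (x ^ (M - N - 1))"
proof -
  \<comment> \<open>The exponent may be a half-integer, so the modulus of the power is squared and \<open>y \<le> 1 + y\<^sup>2\<close> is used.\<close>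
  have "(norm (x powr \<alpha>))\<^sup>2 \<le> norm (x ^ (M - N - 1))"
  proof (cases "x = 0")
    case False
    have "norm (x powr \<alpha>) = norm x powr (real (M - N - 1) / 2)"
      by (simp add: \<alpha>_real norm_powr_real_powr')
    then have "(norm (x powr \<alpha>))\<^sup>2 = norm x powr (real (M - N - 1))"
      using False by (simp add: powr_power)
    with False show ?thesis
      by (simp add: powr_realpow norm_power)
  qed simp
  moreover have "y \<le> 1 + y\<^sup>2" for y :: real
  proof -
    have "0 \<le> (y - 1)\<^sup>2 + y\<^sup>2 + 1"
      by simp
    then show ?thesis
      by (simp add: power2_eq_square algebra_simps)
  qed
  ultimately show ?thesis
    by (meson add_left_mono order.trans)
qed

lemma W_bound:
  obtains C where "\<And>s. s \<ge> 0 \<Longrightarrow> norm (W p s) \<le> C * exp (- (real M / 4 * s))"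
proof -
  obtain C1 where C1: "C1 \<ge> 0" "\<And>s. s \<ge> 0 \<Longrightarrow>
      norm (poly p (\<gamma> s) * exp (- (of_real (real M / 2) * \<gamma> s))) \<le> C1 * exp (- (real M / 2 / 2 * s))"
    using poly_exp_bound[of "real M / 2" p] N_less_M by auto
  obtain C2 where C2: "C2 \<ge> 0" "\<And>s. s \<ge> 0 \<Longrightarrow>
      norm (poly (p * monom 1 (M - N - 1)) (\<gamma> s) * exp (- (of_real (real M / 2) * \<gamma> s)))
        \<le> C2 * exp (- (real M / 2 / 2 * s))"
    using poly_exp_bound[of "real M / 2" "p * monom 1 (M - N - 1)"] N_less_M by auto
  obtain C3 where C3: "C3 \<ge> 0" "\<And>s. s \<ge> 0 \<Longrightarrow> norm (inverse (\<rho> (\<gamma> s))) \<le> C3"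
    using inverse_rho_bound by blast
  show ?thesis
  proof (rule that)
    fix s :: real assume "s \<ge> 0"
    define E where "E = exp (- (of_real (real M / 2) * \<gamma> s))"
    have "norm (W p s) = norm (poly p (\<gamma> s) * E) * norm (\<gamma> s powr \<alpha>) * norm (inverse (\<rho> (\<gamma> s)))"
      by (simp add: W_def weight_eq E_def norm_mult)
    also have "\<dots> \<le> norm (poly p (\<gamma> s) * E) * (1 + norm (\<gamma> s ^ (M - N - 1))) * C3"
      using C3(2)[OF \<open>s \<ge> 0\<close>] norm_powr_alpha_le
      by (intro mult_mono) auto
    also have "\<dots> = (norm (poly p (\<gamma> s) * E) + norm (poly (p * monom 1 (M - N - 1)) (\<gamma> s) * E)) * C3"
      by (simp add: norm_mult poly_monom algebra_simps)
    also have "\<dots> \<le> (C1 * exp (- (real M / 2 / 2 * s)) + C2 * exp (- (real M / 2 / 2 * s))) * C3"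
      using C1(2)[OF \<open>s \<ge> 0\<close>] C2(2)[OF \<open>s \<ge> 0\<close>] C3(1) unfolding E_def
      by (intro mult_right_mono add_mono) auto
    finally show "norm (W p s) \<le> (C1 + C2) * C3 * exp (- (real M / 4 * s))"
      by (simp add: algebra_simps)
  qed
qed

lemma continuous_W: "continuous_on {0<..} (W p)"
  unfolding W_def weight_eq
proof (intro continuous_intros)
  show "{0<..} \<subseteq> {s. 0 \<le> Re (\<gamma> s) \<or> Im (\<gamma> s) \<noteq> 0}"
    using Re_path by (auto intro: less_imp_le)
  show "0 < Re \<alpha>" if "s \<in> {0<..}" "\<gamma> s = 0" for s
    using that Re_path[of s] by simp
qed (use rho_nonzero in \<open>auto intro: continuous_on_subset[OF continuous_path] continuous_on_subset[OF continuous_rho]\<close>)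

lemma integrable_W: "set_integrable lborel {0..} (\<lambda>s. W p s * vector_derivative \<gamma> (at s))"
proof -
  obtain C where "\<And>s. s \<ge> 0 \<Longrightarrow> norm (W p s) \<le> C * exp (- (real M / 4 * s))"
    using W_bound by blast
  then show ?thesis
    using N_less_M by (intro integrable_along_path[of "W p" "real M / 4" C] continuous_W) auto
qed

lemma integrable_\<Phi>: "integrable lborel (\<Phi> p)"
  using integrable_W[of p] by (simp add: \<Phi>_def[abs_def] set_integrable_def)

text \<open>The factor \<open>x\<close> of \<open>\<sigma>\<close> raises the exponent of \<open>x\<close> to one with positive real part.  This gives continuity
  at the starting point even if \<open>\<alpha> = 0\<close>, where \<open>x powr \<alpha>\<close> itself jumps because \<open>0 powr 0 = 0\<close>.\<close>

lemma W_sigma_eq: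
  "W (q * \<sigma>) s = poly (q * [:t, - of_real T:]) (\<gamma> s) * exp (- (of_nat M / 2 * \<gamma> s))
     * \<gamma> s powr (\<alpha> + 1) * inverse (\<rho> (\<gamma> s))"
proof -
  have *: "\<gamma> s * \<gamma> s powr \<alpha> = \<gamma> s powr (\<alpha> + 1)"
    by (simp add: powr_add)
  show ?thesis
    unfolding *[symmetric]
    by (simp add: W_def weight_eq \<sigma>_def algebra_simps)
qed

lemma continuous_W_sigma: "continuous_on {0..} (W (q * \<sigma>))"
  unfolding W_sigma_eq
proof (intro continuous_intros continuous_path continuous_rho)
  show "{0..} \<subseteq> {s. 0 \<le> Re (\<gamma> s) \<or> Im (\<gamma> s) \<noteq> 0}"
    using Re_path path_0 by (auto intro: less_imp_le simp: le_less)
  show "0 < Re (\<alpha> + 1)" for s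
    by (simp add: \<alpha>_real)
qed (use rho_nonzero in auto)

lemma W_tendsto_0: "(W p \<longlongrightarrow> 0) at_top"
proof -
  obtain C where C: "\<And>s. s \<ge> 0 \<Longrightarrow> norm (W p s) \<le> C * exp (- (real M / 4 * s))"
    using W_bound by blast
  have "real M > 0"
    using N_less_M by simp
  then have "((\<lambda>s. C * exp (- (real M / 4 * s))) \<longlongrightarrow> 0) at_top"
    by real_asymp
  then show ?thesis
    by (rule Lim_null_comparison[OF eventually_mono[OF eventually_ge_at_top[of 0] C], rotated])
qed

text \<open>The derivative of \<open>q \<sigma> w\<close> along the contour.  It is computed for \<open>G \<rho>\<close>, where \<open>G\<close> collects the factors
  that are holomorphic in the right half plane, because \<open>\<sigma> / \<rho> = x \<rho>\<close> and the branch \<open>\<rho>\<close> is given on the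
  contour only.\<close>

lemma W_sigma_deriv:
  assumes "s > 0" and \<gamma>': "(\<gamma> has_vector_derivative v) (at s)"
  shows "(W (q * \<sigma>) has_vector_derivative W (D q) s * v) (at s)"
proof -
  let ?x = "\<gamma> s"
  have x: "?x \<noteq> 0" "?x \<notin> \<real>\<^sub>\<le>\<^sub>0" and r: "\<rho> ?x \<noteq> 0" and r2: "(\<rho> ?x)\<^sup>2 = t - of_real T * ?x"
    using Re_path[OF \<open>s > 0\<close>] rho_nonzero[of s] rho_square[of s] \<open>s > 0\<close>
    by (auto simp: complex_nonpos_Reals_iff)
  have nhds: "\<forall>\<^sub>F u in nhds s. u > 0"
    using \<open>s > 0\<close> by (intro eventually_nhds_in_open[of "{0<..}", simplified]) auto
  have \<rho>': "((\<lambda>s. \<rho> (\<gamma> s)) has_vector_derivative (- of_real T * v) / (2 * \<rho> ?x)) (at s)"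
  proof (rule has_vector_derivative_sqrt_branch)
    show "((\<lambda>u. t - of_real T * \<gamma> u) has_vector_derivative - of_real T * v) (at s)"
      by (rule has_vector_derivative_eq_rhs, (rule derivative_intros \<gamma>')+) simp
    have "continuous_on {0<..} (\<lambda>s. \<rho> (\<gamma> s))"
      by (rule continuous_on_subset[OF continuous_rho]) auto
    then show "isCont (\<lambda>s. \<rho> (\<gamma> s)) s"
      using \<open>s > 0\<close> by (simp add: continuous_on_eq_continuous_at)
    show "\<forall>\<^sub>F u in nhds s. (\<rho> (\<gamma> u))\<^sup>2 = t - of_real T * \<gamma> u"
      using nhds by eventually_elim (simp add: rho_square)
  qed (use r in simp)
  define G where "G x = poly (q * [:0, 1:]) x * exp (- (of_nat M / 2 * x)) * x powr \<alpha>" for x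
  define G' where "G' = (poly (pderiv (q * [:0, 1:])) ?x
      + poly (q * [:0, 1:]) ?x * (\<alpha> / ?x - of_nat M / 2)) * exp (- (of_nat M / 2 * ?x)) * ?x powr \<alpha>"
  have "?x powr (\<alpha> - 1) = ?x powr \<alpha> / ?x"
    using x(1) by (simp add: powr_diff)
  then have "(G has_field_derivative G') (at ?x)"
    unfolding G_def[abs_def] G'_def using x
    by (auto intro!: derivative_eq_intros poly_DERIV has_field_derivative_powr simp: pderiv_pCons algebra_simps)
  then have "((\<lambda>u. G (\<gamma> u)) has_vector_derivative v * G') (at s)"
    using field_vector_diff_chain_at[OF \<gamma>'] by (simp add: o_def)
  then have "((\<lambda>u. G (\<gamma> u) * \<rho> (\<gamma> u)) has_vector_derivative
      G ?x * ((- of_real T * v) / (2 * \<rho> ?x)) + v * G' * \<rho> ?x) (at s)"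
    using \<rho>' by (rule has_vector_derivative_mult)
  also have "G ?x * ((- of_real T * v) / (2 * \<rho> ?x)) + v * G' * \<rho> ?x = W (D q) s * v"
  proof -
    define E where "E = exp (- (of_nat M / 2 * ?x)) * ?x powr \<alpha>"
    have "W (D q) s = poly (D q) ?x * E / \<rho> ?x"
      by (simp add: W_def weight_eq E_def field_simps)
    moreover have "poly (D q) ?x = (poly (pderiv (q * [:0, 1:])) ?x
      + poly (q * [:0, 1:]) ?x * (\<alpha> / ?x - of_nat M / 2)) * (\<rho> ?x)\<^sup>2
      - poly (q * [:0, 1:]) ?x * of_real T / 2"
      using x(1) unfolding r2
      by (simp add: D_def \<nu>_def \<sigma>_def pderiv_mult pderiv_pCons pderiv_add pderiv_minus pderiv_smult field_simps)
    moreover have "G ?x = poly (q * [:0, 1:]) ?x * E"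
      by (simp add: G_def E_def mult.assoc)
    moreover have "G' = (poly (pderiv (q * [:0, 1:])) ?x
      + poly (q * [:0, 1:]) ?x * (\<alpha> / ?x - of_nat M / 2)) * E"
      by (simp add: G'_def E_def mult.assoc)
    moreover have "Q * E * ((- of_real T * v) / (2 * r)) + v * (B * E) * r
        = (B * r\<^sup>2 - Q * of_real T / 2) * E / r * v" if "r \<noteq> 0" for Q B r :: complex
      using that by (simp add: field_simps power2_eq_square)
    ultimately show ?thesis
      using r by metis
  qed
  finally show ?thesis
  proof (rule has_vector_derivative_transform_within_open[of _ _ _ "{0<..}"])
    fix u :: real assume "u \<in> {0<..}"
    then have u: "\<rho> (\<gamma> u) \<noteq> 0" "(\<rho> (\<gamma> u))\<^sup>2 = t - of_real T * \<gamma> u"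
      using rho_nonzero[of u] rho_square[of u] by auto
    have "G (\<gamma> u) * \<rho> (\<gamma> u) = G (\<gamma> u) * (\<rho> (\<gamma> u))\<^sup>2 * inverse (\<rho> (\<gamma> u))"
      using u(1) by (simp add: power2_eq_square)
    then show "G (\<gamma> u) * \<rho> (\<gamma> u) = W (q * \<sigma>) u"
      unfolding u(2) by (simp add: G_def W_def weight_eq \<sigma>_def algebra_simps)
  qed (use \<open>s > 0\<close> in auto)
qed

lemma sgn_integral_D:
  assumes "s \<ge> 0"
  shows "(LBINT u:{0..}. of_real (sgn (s - u) / 2) * (W (D q) u * vector_derivative \<gamma> (at u)))
       = W (q * \<sigma>) s"
proof -
  obtain A where A: "finite A"
    "\<And>s. 0 < s \<Longrightarrow> s \<notin> A \<Longrightarrow> (\<gamma> has_vector_derivative vector_derivative \<gamma> (at s)) (at s)"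
    using smooth_path by metis
  show ?thesis
  proof (rule half_line_sgn_FTC[OF A(1) continuous_W_sigma _ integrable_W W_tendsto_0 assms])
    show "W (q * \<sigma>) 0 = 0"
      by (simp add: W_def \<sigma>_def path_0)
  qed (use A(2) W_sigma_deriv in blast)
qed

lemma skew_product_eq: "skew_product1 \<gamma> (weight1 M N \<rho>) (poly p) (poly q) = sgn_form (\<Phi> p) (\<Phi> q)"
  unfolding skew_product1_def sgn_form_def set_lebesgue_integral_def integral_scaleR_right[symmetric]
  by (intro Bochner_Integration.integral_cong refl)
     (simp add: \<Phi>_def W_def indicator_def scaleR_conv_of_real mult_ac)

lemma W_times_W_sigma:
  assumes "s \<ge> 0"
  shows "W p s * W (q * \<sigma>) s = poly (p * q) (\<gamma> s) * weight0 M N (\<gamma> s)"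
proof (cases "s = 0")
  case True
  then show ?thesis
    using N_less_M by (simp add: W_def \<sigma>_def weight0_def path_0)
next
  case False
  let ?x = "\<gamma> s"
  have x: "?x \<noteq> 0" and r: "\<rho> ?x \<noteq> 0" "(\<rho> ?x)\<^sup>2 = t - of_real T * ?x"
    using False assms path_eq_0_iff rho_nonzero rho_square by auto
  have "?x powr \<alpha> * ?x powr \<alpha> = ?x powr of_nat (M - N - 1)"
    by (simp add: \<alpha>_real flip: powr_add of_real_add)
  also have "\<dots> = ?x ^ (M - N - 1)"
    using x by (simp add: powr_nat)
  finally have pow: "?x * (?x powr \<alpha> * ?x powr \<alpha>) = ?x ^ (M - N)"
    using N_less_M by (simp add: Suc_diff_Suc flip: power_Suc)
  have ex: "exp (- (of_nat M / 2 * ?x)) * exp (- (of_nat M / 2 * ?x)) = exp (- (of_nat M * ?x))"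
    by (simp flip: exp_add)
  have "W p s * W (q * \<sigma>) s = poly p ?x * poly q ?x
      * (?x * (?x powr \<alpha> * ?x powr \<alpha>))
      * (exp (- (of_nat M / 2 * ?x)) * exp (- (of_nat M / 2 * ?x)))
      * ((\<rho> ?x)\<^sup>2 * inverse (\<rho> ?x) * inverse (\<rho> ?x))"
    unfolding r(2) W_def weight_eq \<sigma>_def by (simp add: algebra_simps)
  also have "\<dots> = poly (p * q) ?x * weight0 M N ?x"
    unfolding pow ex using r(1) by (simp add: weight0_def power2_eq_square field_simps)
  finally show ?thesis .
qed

text \<open>The inner integral against the sign kernel is \<open>q \<sigma> w\<close>, and \<open>\<sigma> w\<^sup>2 = w\<^sub>0\<close>.\<close>

lemma sgn_form_D:
  "sgn_form (\<Phi> p) (\<Phi> (D q)) = integral_along \<gamma> (\<lambda>x. poly (p * q) x * weight0 M N x)"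
proof -
  have "sgn_form (\<Phi> p) (\<Phi> (D q)) = (LBINT s. \<Phi> p s *
      (LBINT u:{0..}. of_real (sgn (s - u) / 2) * (W (D q) u * vector_derivative \<gamma> (at u))))"
    unfolding sgn_form_def set_lebesgue_integral_def integral_mult_right_zero[symmetric]
    by (intro Bochner_Integration.integral_cong refl)
       (simp add: \<Phi>_def scaleR_conv_of_real mult_ac)
  also have "\<dots> = (LBINT s:{0..}. poly (p * q) (\<gamma> s) * weight0 M N (\<gamma> s) * vector_derivative \<gamma> (at s))"
    unfolding set_lebesgue_integral_def[of _ "{0..}" "\<lambda>s. poly (p * q) (\<gamma> s) * weight0 M N (\<gamma> s) * vector_derivative \<gamma> (at s)"]
  proof (intro Bochner_Integration.integral_cong refl)
    fix s :: real
    show "\<Phi> p s * (LBINT u:{0..}. of_real (sgn (s - u) / 2) * (W (D q) u * vector_derivative \<gamma> (at u)))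
      = indicator {0..} s *\<^sub>R (poly (p * q) (\<gamma> s) * weight0 M N (\<gamma> s) * vector_derivative \<gamma> (at s))"
    proof (cases "s \<ge> 0")
      case True
      then show ?thesis
        unfolding sgn_integral_D[OF True] W_times_W_sigma[OF True, symmetric]
        by (simp add: \<Phi>_def mult_ac)
    qed (simp add: \<Phi>_def)
  qed
  finally show ?thesis
    by (simp add: integral_along_def)
qed

lemma \<Phi>_add: "\<Phi> (p + q) = (\<lambda>s. \<Phi> p s + \<Phi> q s)"
  by (simp add: fun_eq_iff \<Phi>_def W_def algebra_simps)

lemma \<Phi>_smult: "\<Phi> (smult c p) = (\<lambda>s. c * \<Phi> p s)"
  by (simp add: fun_eq_iff \<Phi>_def W_def algebra_simps)

end

section \<open>The skew orthogonal polynomials\<close>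

theorem proposition1:
  fixes M N k :: nat and \<tau> :: real and t :: complex
    and \<gamma> :: "real \<Rightarrow> complex" and \<rho> :: "complex \<Rightarrow> complex"
    and L :: "nat \<Rightarrow> complex poly"
    and S :: "complex poly \<Rightarrow> complex poly \<Rightarrow> complex"
  assumes "0 < N" and "N < M" and "even N"
    and "\<tau> > -1" and "\<tau> \<noteq> 0" and "t \<noteq> 0"
    and "half_line_contour (t / of_real (tau_tilde \<tau>)) \<gamma>"
    and "sqrt_branch_on (\<gamma> ` {0..}) (\<lambda>x. t - of_real (tau_tilde \<tau>) * x) \<rho>"
    and "monic_orthogonal_polys \<gamma> (weight0 M N) L"
    and S: "\<And>p q. S p q = skew_product1 \<gamma> (weight1 M N \<rho>) (poly p) (poly q)"
    and "k \<ge> 1"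
    and "S (L (2*k-1)) (L (2*k-2)) \<noteq> 0"
  shows
    "(\<exists>!p. skew_orthogonal_even S k p) \<and>
     (\<exists>q. skew_orthogonal_odd S k q) \<and>
     (\<forall>p q q'. skew_orthogonal_even S k p \<longrightarrow> skew_orthogonal_odd S k q \<longrightarrow>
        (skew_orthogonal_odd S k q' \<longleftrightarrow> (\<exists>c. q' = q + smult c p))) \<and>
     S (L (2*k)) (L (2*k-1)) = 0 \<and>
     (\<forall>p. skew_orthogonal_even S k p \<longleftrightarrow>
        p = L (2*k) - smult (S (L (2*k)) (L (2*k-2)) / S (L (2*k-1)) (L (2*k-2))) (L (2*k-1))) \<and>
     (\<forall>p q. skew_orthogonal_even S k p \<longrightarrow>
        (skew_orthogonal_odd S k q \<longleftrightarrow>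
          (\<exists>c. q = L (2*k+1)
             - smult (S (L (2*k+1)) (L (2*k-2)) / S (L (2*k-1)) (L (2*k-2))) (L (2*k-1))
             + smult (S (L (2*k+1)) (L (2*k-1)) / S (L (2*k-1)) (L (2*k-2))) (L (2*k-2))
             + smult c p)))"
proof -
  define T where "T = tau_tilde \<tau>"
  have "T \<noteq> 0"
    using assms(4,5) by (simp add: T_def tau_tilde_def)
  interpret laguerre_contour \<gamma> \<rho> t T M N
    by unfold_locales (use assms(2,7,8) \<open>T \<noteq> 0\<close> in \<open>simp_all add: T_def\<close>)
  have S_eq: "S p q = sgn_form (\<Phi> p) (\<Phi> q)" for p q
    by (simp add: S skew_product_eq)
  define I where "I p = integral_along \<gamma> (\<lambda>x. poly p x * weight0 M N x)" for p
  interpret form: skew_moment_form S I D L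
  proof
    show "S (p + q) r = S p r + S q r" for p q r
      by (simp add: S_eq \<Phi>_add sgn_form_add integrable_\<Phi>)
    show "S (smult c p) r = c * S p r" for c p r
      by (simp add: S_eq \<Phi>_smult sgn_form_mult)
    show "S p q = - S q p" for p q
      unfolding S_eq by (rule sgn_form_skew) (rule integrable_\<Phi>)+
    show "S p (D q) = I (p * q)" for p q
      by (simp add: S_eq I_def sgn_form_D)
    show "monic_of_degree j (L j)" for j
      using assms(9) by (simp add: monic_orthogonal_polys_def)
    show "I (L i * L j) = 0" if "i \<noteq> j" for i j
      using assms(9) that by (simp add: I_def monic_orthogonal_polys_def)
    show "I (L j * L j) \<noteq> 0" for j
      using orthogonal_polys_norm[OF assms(9)] assms(2) by (simp add: I_def)
  qed (simp_all add: D_add D_smult degree_D)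
  define m where "m = 2 * k - 2"
  have k: "2 * k = m + 2" "2 * k - 1 = m + 1" "2 * k - 2 = m" "2 * k + 1 = m + 3" and "even m"
    using \<open>k \<ge> 1\<close> by (auto simp: m_def)
  define P where "P = L (m + 2) - smult (S (L (m + 2)) (L m) / S (L (m + 1)) (L m)) (L (m + 1))"
  define Q where "Q = L (m + 3) - smult (S (L (m + 3)) (L m) / S (L (m + 1)) (L m)) (L (m + 1))
                 + smult (S (L (m + 3)) (L (m + 1)) / S (L (m + 1)) (L m)) (L m)"
  have nz: "S (L (m + 1)) (L m) \<noteq> 0"
    using assms(12) unfolding k(2,3) .
  have even: "skew_orthogonal_even S k p \<longleftrightarrow> p = P" for p
    unfolding skew_orthogonal_even_def P_def k
    by (rule form.even_skew_orthogonal_iff[OF \<open>even m\<close> nz])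
  have odd: "skew_orthogonal_odd S k q \<longleftrightarrow> (\<exists>c. q = Q + smult c P)" for q
    unfolding skew_orthogonal_odd_def P_def Q_def k(4) unfolding k(1)
    by (rule form.odd_skew_orthogonal_iff[OF \<open>even m\<close> nz])
  have odd_coset: "skew_orthogonal_odd S k q' \<longleftrightarrow> (\<exists>c. q' = q + smult c P)"
    if "skew_orthogonal_odd S k q" for q q'
  proof -
    obtain a where q: "q = Q + smult a P"
      using \<open>skew_orthogonal_odd S k q\<close>[unfolded odd] ..
    have eq: "q + smult b P = Q + smult (a + b) P" "Q + smult b P = q + smult (b - a) P" for b
      by (simp_all add: q smult_diff_left smult_add_left)
    show ?thesis
      unfolding odd
    proof
      assume "\<exists>c. q' = Q + smult c P"
      then obtain b where "q' = Q + smult b P" ..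
      then show "\<exists>c. q' = q + smult c P"
        unfolding eq(2) ..
    next
      assume "\<exists>c. q' = q + smult c P"
      then obtain b where "q' = q + smult b P" ..
      then show "\<exists>c. q' = Q + smult c P"
        unfolding eq(1) ..
    qed
  qed
  have zero: "S (L (m + 2)) (L (m + 1)) = 0"
    using form.S_consecutive_even[of "m + 1"] \<open>even m\<close> by simp
  show ?thesis
    unfolding even unfolding k(2-4) unfolding k(1) unfolding P_def[symmetric] Q_def[symmetric]
  proof (intro conjI allI impI)
    show "\<exists>q. skew_orthogonal_odd S k q"
      unfolding odd by (intro exI[of _ Q] exI[of _ 0]) simp
    show "skew_orthogonal_odd S k q' \<longleftrightarrow> (\<exists>c. q' = q + smult c p)"
      if "p = P" and "skew_orthogonal_odd S k q" for p q q'
      unfolding \<open>p = P\<close> by (rule odd_coset) fact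
    show "S (L (m + 2)) (L (m + 1)) = 0"
      by (rule zero)
  qed (simp_all add: odd)
qed

end
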